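(* Let $\varepsilon>0$, $T>0$, let $N_T$ and $N$ be two positive integers, and let $(\rho^0,u^0)\in X(\mathcal T)\times X(\mathcal T^\star)$ be the cell averages $$\rho^0_i=\frac1{\Delta x}\int_{C_i}\rho_\varepsilon^{\rm ini}(x)\,dx,\qquad u^0_{i+\frac12}=\frac1{\Delta x}\int_{C_{i+\frac12}}u_\varepsilon^{\rm ini}(x)\,dx$$ of given functions $\rho_\varepsilon^{\rm ini}:\mathbb T\to[0,+\infty)$ and $u_\varepsilon^{\rm ini}:\mathbb T\to\mathbb R$, and assume $\rho^0>0$. Assume that $\phi^0\in X(\mathcal T)$ satisfies the discrete Poisson equation initially, i.e. $\varepsilon^2(\Delta\phi^0)_i+e^{-\phi^0_i}=\rho^0_i$ for all $i\in\{0,\dots,N\}$. Then there exists a solution $(\rho^n,u^n,\phi^n)_{n=0,\dots,N_T}\subset X(\mathcal T)\times X(\mathcal T^\star)\times X(\mathcal T)$ to the numerical scheme (defined in the context) with initial data $(\rho^0,u^0,\phi^0)$. In addition, this solution satisfies, for all $0\le n\le N_T$: (1) $\rho^n>0$ on $\mathbb T$; (2) $\|\rho^n\|_{L^1(\mathbb T)}=\|\rho^0\|_{L^1(\mathbb T)}$; (3) $\mathcal H(\rho^n,u^n,\phi^n)+\Delta t\sum_{k=1}^{n}\tau^k=\mathcal H(\rho^0,u^0,\phi^0)$, where $\tau^k\ge 0$ is the dissipation defined in the context; (4) the elliptic estimates, where $\langle\phi^n\rangle=\sum_{i=0}^N\phi^n_i\Delta x$ and $\alpha^n=\exp\big(\min_{0\le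 i\le N}\log\rho^n_i\big)$: (4a) for all $p\in[1,+\infty)$, $\|e^{-\phi^n}\|_{L^p(\mathbb T)}\le\|\rho^n\|_{L^p(\mathbb T)}$, with equality for $p=1$; (4b) for all $p\in[1,+\infty)$, $\displaystyle\varepsilon^2\sum_{i=0}^N\Big|\frac{\phi^n_{i+1}-\phi^n_i}{\Delta x}\,\frac{e^{-(p-1)\phi^n_{i+1}}-e^{-(p-1)\phi^n_i}}{\Delta x}\Big|\Delta x\le\|\rho^n\|_{L^p(\mathbb T)}^p$; (4c) for all $i\in\{0,\dots,N\}$, $\min_{0\le j\le N}\log\rho^n_j\le-\phi^n_i\le\max_{0\le j\le N}\log\rho^n_j$; (4d) $\min_{0\le j\le N}\log\rho^n_j\le\langle-\phi^n\rangle\le\max_{0\le j\le N}\log\rho^n_j$; (4e) $\alpha^n\|\phi^n-\langle\phi^n\rangle\|_{L^2(\mathbb T)}\le\|\rho^n\|_{L^2(\mathbb T)}+\|\rho^n\|_{L^1(\mathbb T)}$; (4f) $\varepsilon\,|\phi^n-\langle\phi^n\rangle|_{H^1(\mathbb T)}\le\frac1{\sqrt{\alpha^n}}\big(\|\rho^n\|_{L^2(\mathbb T)}+\|\rho^n\|_{L^1(\mathbb T)}\big)$.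
   Context: **Grid and spaces.** $\mathbb T=\mathbb R/\mathbb Z$, $\Delta x=\frac1{N+1}$, $x_i=i\Delta x$, $x_{i+\frac12}=x_i+\frac{\Delta x}2$, all integer indices $i$ being understood modulo $N+1$ (representatives in $\{0,\dots,N\}$). Cells: $C_i=[x_i-\frac{\Delta x}2,x_i+\frac{\Delta x}2)$ and $C_{i+\frac12}=[x_{i+\frac12}-\frac{\Delta x}2,x_{i+\frac12}+\frac{\Delta x}2)$. $X(\mathcal T)$ (resp. $X(\mathcal T^\star)$) is the space of real functions on $\mathbb T$ constant on each $C_i$ with value $v_i$ (resp. on each $C_{i+\frac12}$ with value $v_{i+\frac12}$), $i\in\{0,\dots,N\}$. $L^p(\mathbb T)$ norms are the usual ones. For $\varphi\in X(\mathcal T)$: $(\delta\varphi)_{i+\frac12}=\delta(\varphi)_{i+\frac12}=\frac{\varphi_{i+1}-\varphi_i}{\Delta x}$, $(\Delta\varphi)_i=\frac{\varphi_{i+1}-2\varphi_i+\varphi_{i-1}}{\Delta x^2}$, $|\varphi|_{H^1(\mathbb T)}=\big(\sum_{i=0}^N|(\delta\varphi)_{i+\frac12}|^2\Delta x\big)^{1/2}$. **The function $g$.** $g:\mathbb R\to\mathbb R$ is a fixed Lipschitz function, differentiable at $0$, with $g(u)\ge\max(u,0)$ for all $u\in\mathbb R$. Set $G(s,t,u)=s\,g(u)-t\,(g(u)-u)$ for $(s,t,u)\in\mathbb R^3$. **Scheme.** $\Delta t=T/N_T$. A solution is a family $(\rho^n,u^n,\phi^n)_{n=0,\dots,N_T}\subset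 X(\mathcal T)\times X(\mathcal T^\star)\times X(\mathcal T)$ such that for all $n\in\{0,\dots,N_T-1\}$ and $i\in\{0,\dots,N\}$: $$\frac{\rho_i^{n+1}-\rho_i^n}{\Delta t}+\frac{\mathcal F^{n+1}_{i+\frac12}-\mathcal F^{n+1}_{i-\frac12}}{\Delta x}=0,$$ $$\frac{\rho^{n+1}_{i+\frac12}u^{n+1}_{i+\frac12}-\rho^n_{i+\frac12}u^n_{i+\frac12}}{\Delta t}+\frac{\mathcal F^{n+1}_{i+1}u^{n+1}_{i+1}-\mathcal F^{n+1}_iu^{n+1}_i}{\Delta x}=\tilde\rho^{n+1}_{i+\frac12}\,\delta(\phi^{n+1})_{i+\frac12},$$ $$\varepsilon^2(\Delta\phi^{n+1})_i+e^{-\phi^{n+1}_i}=\rho^{n+1}_i,$$ with $\mathcal F^{n+1}_{i+\frac12}=G(\rho^{n+1}_i,\rho^{n+1}_{i+1},u^{n+1}_{i+\frac12})$, $\mathcal F^{n+1}_i=\frac12(\mathcal F^{n+1}_{i+\frac12}+\mathcal F^{n+1}_{i-\frac12})$, $\rho^n_{i+\frac12}=\frac12(\rho^n_i+\rho^n_{i+1})$ for all $n$; $u^{n+1}_i=u^{n+1}_{i-\frac12}$ if $\mathcal F^{n+1}_i\ge0$ and $u^{n+1}_i=u^{n+1}_{i+\frac12}$ if $\mathcal F^{n+1}_i<0$; and $$\tilde\rho^{n+1}_{i+\frac12}=\begin{cases}\dfrac{G(\rho^{n+1}_i,\rho^{n+1}_{i+1},u^{n+1}_{i+\frac12})-G(\rho^{n+1}_i,\rho^{n+1}_{i+1},0)}{u^{n+1}_{i+\frac12}}&\text{if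 }u^{n+1}_{i+\frac12}\ne0,\\ \rho^{n+1}_{i+1}-(\rho^{n+1}_{i+1}-\rho^{n+1}_i)g'(0)&\text{if }u^{n+1}_{i+\frac12}=0.\end{cases}$$ **Energy.** With $h(s)=-(s+1)e^{-s}$, $$\mathcal H(\rho,u,\phi)=\sum_{i=0}^N\Big(\rho_{i+\frac12}\frac{u_{i+\frac12}^2}2+\frac{\varepsilon^2}2\Big|\frac{\phi_{i+1}-\phi_i}{\Delta x}\Big|^2+h(\phi_i)\Big)\Delta x,\qquad \rho_{i+\frac12}=\tfrac12(\rho_i+\rho_{i+1}).$$ **Dissipation.** For $n\in\{0,\dots,N_T-1\}$, $$\tau^{n+1}=\sum_{i=0}^N\Big(\mathcal S^{n+1}_i+e^{-\xi^n_i}\frac{(\phi^{n+1}_i-\phi^n_i)^2}{2\Delta t}\Big)\Delta x+\frac{\varepsilon^2}{2\Delta t}\sum_{i=0}^N\big(\delta(\phi^{n+1})_{i+\frac12}-\delta(\phi^n)_{i+\frac12}\big)^2\Delta x$$ $$+\frac{g(0)}{\Delta x}\sum_{i=0}^N\varepsilon^2\big|\delta(\phi^{n+1})_{i+\frac12}-\delta(\phi^{n+1})_{i-\frac12}\big|^2\Delta x+\frac{g(0)}{\Delta x}\sum_{i=0}^N\big|(e^{-\phi^{n+1}_i}-e^{-\phi^{n+1}_{i-1}})(\phi^{n+1}_i-\phi^{n+1}_{i-1})\big|\Delta x,$$ where $$\mathcal S^{n+1}_i=-\mathcal F^{n+1}_{i+1}\frac{(u^{n+1}_{i+1}-u^{n+1}_{i+\frac12})^2}{2\Delta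 x}+\mathcal F^{n+1}_i\frac{(u^{n+1}_i-u^{n+1}_{i+\frac12})^2}{2\Delta x}+\rho^n_{i+\frac12}\frac{(u^n_{i+\frac12}-u^{n+1}_{i+\frac12})^2}{2\Delta t}$$ (which is $\geq 0$), and $\xi^n_i$ are suitable numbers (whose existence is part of the assertion) lying strictly between $\phi^n_i$ and $\phi^{n+1}_i$ (equal to the common value if $\phi^n_i=\phi^{n+1}_i$). *)

theory Defs
  imports "HOL-Analysis.Analysis"
begin

text \<open>
  Functions on the torus \<open>\<real>/\<int>\<close> are represented by 1-periodic functions on the reals, and
  integrals over the torus by integrals over \<open>{0..<1}\<close>. Grid points and cells are indexed by all
  integers \<open>i\<close>; by periodicity, nodal values only depend on \<open>i\<close> modulo \<open>N + 1\<close>.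
  For dual (half-integer) quantities, the argument \<open>i\<close> stands for the index \<open>i + 1/2\<close>, so that
  \<open>i - 1\<close> stands for \<open>i - 1/2\<close>.
\<close>

definition torus_fun :: "(real \<Rightarrow> real) \<Rightarrow> bool" where
  "torus_fun f \<longleftrightarrow> (\<forall>x. f (x + 1) = f x)"

definition torus_integrable :: "(real \<Rightarrow> real) \<Rightarrow> bool" where
  "torus_integrable f \<longleftrightarrow> set_integrable lebesgue {0..<1} f"

definition Lp_norm :: "real \<Rightarrow> (real \<Rightarrow> real) \<Rightarrow> real" where
  "Lp_norm p f = (LINT x:{0..<1}|lebesgue. \<bar>f x\<bar> powr p) powr (1 / p)"

definition dx :: "nat \<Rightarrow> real" where
  "dx N = 1 / (real N + 1)"

definition primal_pt :: "nat \<Rightarrow> int \<Rightarrow> real" where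
  "primal_pt N i = of_int i * dx N"

definition dual_pt :: "nat \<Rightarrow> int \<Rightarrow> real" where
  "dual_pt N i = primal_pt N i + dx N / 2"

definition primal_cell :: "nat \<Rightarrow> int \<Rightarrow> real set" where
  "primal_cell N i = {primal_pt N i - dx N / 2 ..< primal_pt N i + dx N / 2}"

definition dual_cell :: "nat \<Rightarrow> int \<Rightarrow> real set" where
  "dual_cell N i = {dual_pt N i - dx N / 2 ..< dual_pt N i + dx N / 2}"

definition X_primal :: "nat \<Rightarrow> (real \<Rightarrow> real) set" where
  "X_primal N = {v. torus_fun v \<and> (\<forall>i\<in>{0..int N}. v constant_on primal_cell N i)}"

definition X_dual :: "nat \<Rightarrow> (real \<Rightarrow> real) set" where
  "X_dual N = {v. torus_fun v \<and> (\<forall>i\<in>{0..int N}. v constant_on dual_cell N i)}"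

text \<open>The values \<open>v\<^sub>i\<close> and \<open>v\<close> at \<open>i + 1/2\<close> of piecewise constant functions on the two meshes.\<close>

definition pval :: "nat \<Rightarrow> (real \<Rightarrow> real) \<Rightarrow> int \<Rightarrow> real" where
  "pval N v i = v (primal_pt N i)"

definition dval :: "nat \<Rightarrow> (real \<Rightarrow> real) \<Rightarrow> int \<Rightarrow> real" where
  "dval N v i = v (dual_pt N i)"

definition disc_delta :: "nat \<Rightarrow> (real \<Rightarrow> real) \<Rightarrow> int \<Rightarrow> real" where
  "disc_delta N \<phi> i = (pval N \<phi> (i + 1) - pval N \<phi> i) / dx N"

definition disc_laplace :: "nat \<Rightarrow> (real \<Rightarrow> real) \<Rightarrow> int \<Rightarrow> real" where
  "disc_laplace N \<phi> i = (pval N \<phi> (i + 1) - 2 * pval N \<phi> i + pval N \<phi> (i - 1)) / (dx N)\<^sup>2"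

definition H1_seminorm :: "nat \<Rightarrow> (real \<Rightarrow> real) \<Rightarrow> real" where
  "H1_seminorm N \<phi> = sqrt (\<Sum>i\<in>{0..int N}. \<bar>disc_delta N \<phi> i\<bar>\<^sup>2 * dx N)"

definition disc_mean :: "nat \<Rightarrow> (real \<Rightarrow> real) \<Rightarrow> real" where
  "disc_mean N \<phi> = (\<Sum>i\<in>{0..int N}. pval N \<phi> i * dx N)"

definition Gfun :: "(real \<Rightarrow> real) \<Rightarrow> real \<Rightarrow> real \<Rightarrow> real \<Rightarrow> real" where
  "Gfun g s t u = s * g u - t * (g u - u)"

definition flux_dual :: "(real \<Rightarrow> real) \<Rightarrow> nat \<Rightarrow> (real \<Rightarrow> real) \<Rightarrow> (real \<Rightarrow> real) \<Rightarrow> int \<Rightarrow> real" where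
  "flux_dual g N \<rho> u i = Gfun g (pval N \<rho> i) (pval N \<rho> (i + 1)) (dval N u i)"

definition flux_primal :: "(real \<Rightarrow> real) \<Rightarrow> nat \<Rightarrow> (real \<Rightarrow> real) \<Rightarrow> (real \<Rightarrow> real) \<Rightarrow> int \<Rightarrow> real" where
  "flux_primal g N \<rho> u i = (flux_dual g N \<rho> u i + flux_dual g N \<rho> u (i - 1)) / 2"

definition rho_dual :: "nat \<Rightarrow> (real \<Rightarrow> real) \<Rightarrow> int \<Rightarrow> real" where
  "rho_dual N \<rho> i = (pval N \<rho> i + pval N \<rho> (i + 1)) / 2"

definition u_upwind :: "(real \<Rightarrow> real) \<Rightarrow> nat \<Rightarrow> (real \<Rightarrow> real) \<Rightarrow> (real \<Rightarrow> real) \<Rightarrow> int \<Rightarrow> real" where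
  "u_upwind g N \<rho> u i =
     (if flux_primal g N \<rho> u i \<ge> 0 then dval N u (i - 1) else dval N u i)"

definition rho_tilde :: "(real \<Rightarrow> real) \<Rightarrow> nat \<Rightarrow> (real \<Rightarrow> real) \<Rightarrow> (real \<Rightarrow> real) \<Rightarrow> int \<Rightarrow> real" where
  "rho_tilde g N \<rho> u i =
     (if dval N u i \<noteq> 0
      then (Gfun g (pval N \<rho> i) (pval N \<rho> (i + 1)) (dval N u i)
            - Gfun g (pval N \<rho> i) (pval N \<rho> (i + 1)) 0) / dval N u i
      else pval N \<rho> (i + 1) - (pval N \<rho> (i + 1) - pval N \<rho> i) * deriv g 0)"

definition disc_poisson :: "real \<Rightarrow> nat \<Rightarrow> (real \<Rightarrow> real) \<Rightarrow> (real \<Rightarrow> real) \<Rightarrow> bool" where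
  "disc_poisson \<epsilon> N \<rho> \<phi> \<longleftrightarrow>
     (\<forall>i\<in>{0..int N}. \<epsilon>\<^sup>2 * disc_laplace N \<phi> i + exp (- pval N \<phi> i) = pval N \<rho> i)"

definition scheme_step ::
  "(real \<Rightarrow> real) \<Rightarrow> real \<Rightarrow> nat \<Rightarrow> real \<Rightarrow> (real \<Rightarrow> real) \<Rightarrow> (real \<Rightarrow> real) \<Rightarrow>
   (real \<Rightarrow> real) \<Rightarrow> (real \<Rightarrow> real) \<Rightarrow> (real \<Rightarrow> real) \<Rightarrow> bool" where
  "scheme_step g \<epsilon> N dt \<rho> u \<rho>' u' \<phi>' \<longleftrightarrow>
     (\<forall>i\<in>{0..int N}.
        (pval N \<rho>' i - pval N \<rho> i) / dt
          + (flux_dual g N \<rho>' u' i - flux_dual g N \<rho>' u' (i - 1)) / dx N = 0) \<and>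
     (\<forall>i\<in>{0..int N}.
        (rho_dual N \<rho>' i * dval N u' i - rho_dual N \<rho> i * dval N u i) / dt
          + (flux_primal g N \<rho>' u' (i + 1) * u_upwind g N \<rho>' u' (i + 1)
             - flux_primal g N \<rho>' u' i * u_upwind g N \<rho>' u' i) / dx N
        = rho_tilde g N \<rho>' u' i * disc_delta N \<phi>' i) \<and>
     disc_poisson \<epsilon> N \<rho>' \<phi>'"

text \<open>The families are only constrained at the time indices \<open>n \<le> NT\<close>.\<close>

definition scheme_solution ::
  "(real \<Rightarrow> real) \<Rightarrow> real \<Rightarrow> nat \<Rightarrow> real \<Rightarrow> nat \<Rightarrow>
   (nat \<Rightarrow> real \<Rightarrow> real) \<Rightarrow> (nat \<Rightarrow> real \<Rightarrow> real) \<Rightarrow> (nat \<Rightarrow> real \<Rightarrow> real) \<Rightarrow> bool" where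
  "scheme_solution g \<epsilon> N T NT \<rho> u \<phi> \<longleftrightarrow>
     (\<forall>n\<le>NT. \<rho> n \<in> X_primal N \<and> u n \<in> X_dual N \<and> \<phi> n \<in> X_primal N) \<and>
     (\<forall>n<NT. scheme_step g \<epsilon> N (T / real NT) (\<rho> n) (u n) (\<rho> (n + 1)) (u (n + 1)) (\<phi> (n + 1)))"

definition hfun :: "real \<Rightarrow> real" where
  "hfun s = - (s + 1) * exp (- s)"

definition energy :: "real \<Rightarrow> nat \<Rightarrow> (real \<Rightarrow> real) \<Rightarrow> (real \<Rightarrow> real) \<Rightarrow> (real \<Rightarrow> real) \<Rightarrow> real" where
  "energy \<epsilon> N \<rho> u \<phi> =
     (\<Sum>i\<in>{0..int N}.
        (rho_dual N \<rho> i * ((dval N u i)\<^sup>2 / 2)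
         + \<epsilon>\<^sup>2 / 2 * \<bar>(pval N \<phi> (i + 1) - pval N \<phi> i) / dx N\<bar>\<^sup>2
         + hfun (pval N \<phi> i)) * dx N)"

text \<open>
  In the next two definitions \<open>\<rho>, u\<close> (and \<open>\<phi>\<close>) are taken at the old time level and the primed
  functions at the new one.
\<close>

definition S_term ::
  "(real \<Rightarrow> real) \<Rightarrow> nat \<Rightarrow> real \<Rightarrow> (real \<Rightarrow> real) \<Rightarrow> (real \<Rightarrow> real) \<Rightarrow>
   (real \<Rightarrow> real) \<Rightarrow> (real \<Rightarrow> real) \<Rightarrow> int \<Rightarrow> real" where
  "S_term g N dt \<rho> u \<rho>' u' i =
     - flux_primal g N \<rho>' u' (i + 1)
         * ((u_upwind g N \<rho>' u' (i + 1) - dval N u' i)\<^sup>2 / (2 * dx N))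
     + flux_primal g N \<rho>' u' i
         * ((u_upwind g N \<rho>' u' i - dval N u' i)\<^sup>2 / (2 * dx N))
     + rho_dual N \<rho> i * ((dval N u i - dval N u' i)\<^sup>2 / (2 * dt))"

definition dissipation_step ::
  "(real \<Rightarrow> real) \<Rightarrow> real \<Rightarrow> nat \<Rightarrow> real \<Rightarrow> (real \<Rightarrow> real) \<Rightarrow> (real \<Rightarrow> real) \<Rightarrow> (real \<Rightarrow> real) \<Rightarrow>
   (real \<Rightarrow> real) \<Rightarrow> (real \<Rightarrow> real) \<Rightarrow> (real \<Rightarrow> real) \<Rightarrow> (int \<Rightarrow> real) \<Rightarrow> real" where
  "dissipation_step g \<epsilon> N dt \<rho> u \<phi> \<rho>' u' \<phi>' \<xi> =
     (\<Sum>i\<in>{0..int N}.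
        (S_term g N dt \<rho> u \<rho>' u' i
         + exp (- \<xi> i) * ((pval N \<phi>' i - pval N \<phi> i)\<^sup>2 / (2 * dt))) * dx N)
     + \<epsilon>\<^sup>2 / (2 * dt) *
         (\<Sum>i\<in>{0..int N}. (disc_delta N \<phi>' i - disc_delta N \<phi> i)\<^sup>2 * dx N)
     + g 0 / dx N *
         (\<Sum>i\<in>{0..int N}. \<epsilon>\<^sup>2 * \<bar>disc_delta N \<phi>' i - disc_delta N \<phi>' (i - 1)\<bar>\<^sup>2 * dx N)
     + g 0 / dx N *
         (\<Sum>i\<in>{0..int N}.
            \<bar>(exp (- pval N \<phi>' i) - exp (- pval N \<phi>' (i - 1)))
              * (pval N \<phi>' i - pval N \<phi>' (i - 1))\<bar> * dx N)"

text \<open>\<open>dissipation \<dots> k\<close> is \<open>\<tau>\<^sup>k\<close>, meaningful for \<open>1 \<le> k \<le> NT\<close>.\<close>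

definition dissipation ::
  "(real \<Rightarrow> real) \<Rightarrow> real \<Rightarrow> nat \<Rightarrow> real \<Rightarrow> (nat \<Rightarrow> real \<Rightarrow> real) \<Rightarrow> (nat \<Rightarrow> real \<Rightarrow> real) \<Rightarrow>
   (nat \<Rightarrow> real \<Rightarrow> real) \<Rightarrow> (nat \<Rightarrow> int \<Rightarrow> real) \<Rightarrow> nat \<Rightarrow> real" where
  "dissipation g \<epsilon> N dt \<rho> u \<phi> \<xi> k =
     dissipation_step g \<epsilon> N dt (\<rho> (k - 1)) (u (k - 1)) (\<phi> (k - 1)) (\<rho> k) (u k) (\<phi> k) (\<xi> (k - 1))"

definition strictly_between :: "real \<Rightarrow> real \<Rightarrow> real \<Rightarrow> bool" where
  "strictly_between a b z \<longleftrightarrow> (if a = b then z = a else min a b < z \<and> z < max a b)"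

definition min_log :: "nat \<Rightarrow> (real \<Rightarrow> real) \<Rightarrow> real" where
  "min_log N \<rho> = Min ((\<lambda>j. ln (pval N \<rho> j)) ` {0..int N})"

definition max_log :: "nat \<Rightarrow> (real \<Rightarrow> real) \<Rightarrow> real" where
  "max_log N \<rho> = Max ((\<lambda>j. ln (pval N \<rho> j)) ` {0..int N})"

definition elliptic_estimates :: "real \<Rightarrow> nat \<Rightarrow> (real \<Rightarrow> real) \<Rightarrow> (real \<Rightarrow> real) \<Rightarrow> bool" where
  "elliptic_estimates \<epsilon> N \<rho> \<phi> \<longleftrightarrow>
     (let \<alpha> = exp (min_log N \<rho>) in
       (\<forall>p\<ge>1. Lp_norm p (\<lambda>x. exp (- \<phi> x)) \<le> Lp_norm p \<rho>) \<and>
       Lp_norm 1 (\<lambda>x. exp (- \<phi> x)) = Lp_norm 1 \<rho> \<and>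
       (\<forall>p\<ge>1. \<epsilon>\<^sup>2 *
          (\<Sum>i\<in>{0..int N}.
             \<bar>(pval N \<phi> (i + 1) - pval N \<phi> i) / dx N
               * ((exp (- (p - 1) * pval N \<phi> (i + 1)) - exp (- (p - 1) * pval N \<phi> i)) / dx N)\<bar>
             * dx N)
          \<le> Lp_norm p \<rho> powr p) \<and>
       (\<forall>i\<in>{0..int N}. min_log N \<rho> \<le> - pval N \<phi> i \<and> - pval N \<phi> i \<le> max_log N \<rho>) \<and>
       min_log N \<rho> \<le> disc_mean N (\<lambda>x. - \<phi> x) \<and> disc_mean N (\<lambda>x. - \<phi> x) \<le> max_log N \<rho> \<and>
       \<alpha> * Lp_norm 2 (\<lambda>x. \<phi> x - disc_mean N \<phi>) \<le> Lp_norm 2 \<rho> + Lp_norm 1 \<rho> \<and>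
       \<epsilon> * H1_seminorm N (\<lambda>x. \<phi> x - disc_mean N \<phi>)
          \<le> 1 / sqrt \<alpha> * (Lp_norm 2 \<rho> + Lp_norm 1 \<rho>))"

end

theory Submission
  imports Defs "HOL-Homology.Brouwer_Degree"
begin

text \<open>
  One time step reduces to a finite-dimensional equation for the velocity alone. For a given
  velocity the implicit mass balance is a linear system with an M-matrix whose columns sum to 1,
  hence uniquely solvable with a positive solution, and the discrete Poisson equation is then
  uniquely solvable by monotonicity and the maximum principle; both solutions depend continuously on
  the data. Testing the remaining momentum residual with the velocity itself gives exactly the energy
  balance, even when the residual does not vanish. So along the homotopy between the identity and the
  residual all zeros have energy at most the initial one, which bounds the velocity, because the
  mass balance keeps \<open>\<rho>\<close> above a multiple of \<open>1 / (1 + max \<bar>u\<bar>)\<close>. A zero exists since spheres are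
  not contractible. The elliptic estimates follow by testing the Poisson equation with powers of
  \<open>exp (- \<phi>)\<close> (and Young's inequality) and with \<open>\<phi> - \<langle>\<phi>\<rangle>\<close>.
\<close>

section \<open>Zeros of maps homotopic to the identity\<close>

text \<open>The energy controls \<open>\<rho> u^2\<close> and not u, so it bounds the velocity only
  if \<rho> does not degenerate too fast. At a cell k where m = |u| is maximal and m \<ge> 1, the
  linear growth of g and the mass balance give \<open>\<rho> k \<ge> const / m\<close>, while the
  energy gives \<open>\<rho> k * m^2 \<le> const\<close>: the quadratic weight wins by one power of
  m. Eliminating \<rho> and \<phi> frees the topological argument from the constraint \<rho> > 0:
  trial velocities fill a whole vector space. The homotopy relaxes only the momentum equation, so
  mass balance and Poisson equation, on which the energy identity rests, hold exactly along it. The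
  price is that the momentum residual must be continuous in u. For \<open>rho_tilde\<close> this is
  where differentiability of g at 0 enters; the upwind velocity jumps, but only where the flux
  multiplying it vanishes. The g(0) terms of the dissipation arise because \<open>rho_tilde\<close>
  times u is the flux minus the flux at zero velocity, and the latter is a diffusion of strength
  g(0).\<close>

lemma homotopic_on_sphere_normalized:
  fixes Q :: "real \<Rightarrow> (nat \<Rightarrow> real) \<Rightarrow> nat \<Rightarrow> real"
  defines "S n \<equiv> {x :: nat \<Rightarrow> real. (\<Sum>i\<le>n. (x i)\<^sup>2) = 1 \<and> (\<forall>i>n. x i = 0)}"
  defines "nrm n v \<equiv> (\<lambda>i. if i \<le> n then v i / sqrt (\<Sum>j\<le>n. (v j)\<^sup>2) else (0::real))"
  assumes cont: "\<And>i. i \<le> n \<Longrightarrow> continuous_on ({0..1} \<times> S n) (\<lambda>z. Q (fst z) (snd z) i)"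
    and nz: "\<And>t x. t \<in> {0..1} \<Longrightarrow> x \<in> S n \<Longrightarrow> \<exists>i\<le>n. Q t x i \<noteq> 0"
  shows "homotopic_with_canon (\<lambda>_. True) (S n) (S n) (\<lambda>x. nrm n (Q 0 x)) (\<lambda>x. nrm n (Q 1 x))"
proof -
  have pos: "(\<Sum>j\<le>n. (Q t x j)\<^sup>2) > 0" if "t \<in> {0..1}" "x \<in> S n" for t x
  proof -
    obtain i where "i \<le> n" "Q t x i \<noteq> 0" using nz \<open>t \<in> {0..1}\<close> \<open>x \<in> S n\<close> by blast
    then show ?thesis by (intro sum_pos2[of _ i]) auto
  qed
  have c: "continuous_on ({0..1} \<times> S n) (\<lambda>z. nrm n (Q (fst z) (snd z)))"
  proof (rule continuous_on_coordinatewise_then_product)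
    fix i
    show "continuous_on ({0..1} \<times> S n) (\<lambda>z. nrm n (Q (fst z) (snd z)) i)"
    proof (cases "i \<le> n")
      case True
      have "continuous_on ({0..1} \<times> S n)
              (\<lambda>z. Q (fst z) (snd z) i / sqrt (\<Sum>j\<le>n. (Q (fst z) (snd z) j)\<^sup>2))"
        using pos by (intro continuous_intros cont True) (auto simp: less_le)
      with True show ?thesis by (simp add: nrm_def)
    qed (simp add: nrm_def)
  qed
  have S: "nrm n (Q t x) \<in> S n" if "t \<in> {0..1}" "x \<in> S n" for t x
  proof -
    have "(\<Sum>i\<le>n. (nrm n (Q t x) i)\<^sup>2) = (\<Sum>i\<le>n. (Q t x i)\<^sup>2 / (\<Sum>j\<le>n. (Q t x j)\<^sup>2))"
      using pos[OF that] by (intro sum.cong) (auto simp: nrm_def power_divide)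
    also have "\<dots> = 1"
      using pos[OF that] by (simp flip: sum_divide_distrib)
    finally show ?thesis by (simp add: S_def nrm_def)
  qed
  show ?thesis
    unfolding homotopic_with_def
    by (rule exI[of _ "\<lambda>z. nrm n (Q (fst z) (snd z))"])
       (use c S in \<open>auto simp: prod_topology_subtopology_eu\<close>)
qed

text \<open>If P had no zero, two homotopies between maps of the unit sphere could be chained: from
  the identity to the normalised P on radius R (no zeros by \<open>bound\<close>), then shrinking
  the radius to 0 (no zeros by assumption). The identity would be homotopic to a constant. Vectors
  are sequences vanishing beyond n, the form in which \<open>nsphere n\<close> is given.\<close>

lemma leray_schauder_zero:
  fixes P :: "(nat \<Rightarrow> real) \<Rightarrow> nat \<Rightarrow> real"
  assumes cont: "\<And>i. i \<le> n \<Longrightarrow> continuous_on UNIV (\<lambda>x. P x i)"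
    and bound: "\<And>t x i. \<lbrakk>0 \<le> t; t \<le> 1; \<And>i. i > n \<Longrightarrow> x i = 0;
                   \<And>i. i \<le> n \<Longrightarrow> (1 - t) * x i + t * P x i = 0; i \<le> n\<rbrakk> \<Longrightarrow> \<bar>x i\<bar> \<le> K"
  shows "\<exists>x. \<forall>i\<le>n. P x i = 0"
proof (rule ccontr)
  assume "\<not> ?thesis"
  then have nz: "\<exists>i\<le>n. P x i \<noteq> 0" for x by blast
  define S where "S = {x :: nat \<Rightarrow> real. (\<Sum>i\<le>n. (x i)\<^sup>2) = 1 \<and> (\<forall>i>n. x i = 0)}"
  define nrm where "nrm v = (\<lambda>i. if i \<le> n then v i / sqrt (\<Sum>j\<le>n. (v j)\<^sup>2) else (0::real))" for v
  \<comment> \<open>Any R with R^2 > (n + 1) K^2 puts the sphere outside the box where all n + 1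
    coordinates are at most K in modulus. The absolute value keeps R positive before the sign of K
    is known.\<close>
  define R where "R = (real n + 1) * (\<bar>K\<bar> + 1)"
  have "R > 0" by (simp add: R_def add_nonneg_pos)
  have out: "\<exists>i\<le>n. (1 - t) * (R * x i) + t * P (\<lambda>i. R * x i) i \<noteq> 0"
    if "t \<in> {0..1}" "x \<in> S" for t x
  proof (rule ccontr)
    assume "\<not> ?thesis"
    then have le: "\<bar>R * x i\<bar> \<le> K" if "i \<le> n" for i
      using bound[of t "\<lambda>i. R * x i"] \<open>t \<in> {0..1}\<close> \<open>x \<in> S\<close> that by (auto simp: S_def)
    then have "\<bar>K\<bar> = K" by (metis abs_ge_zero abs_of_nonneg order_trans le0)
    have "R\<^sup>2 = (\<Sum>i\<le>n. (R * x i)\<^sup>2)"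
      using \<open>x \<in> S\<close> by (simp add: S_def power_mult_distrib flip: sum_distrib_left)
    also have "\<dots> \<le> (\<Sum>i\<le>n. \<bar>K\<bar>\<^sup>2)"
      using le \<open>\<bar>K\<bar> = K\<close> by (intro sum_mono) (simp add: abs_le_square_iff[symmetric])
    also have "\<dots> = (real n + 1) * \<bar>K\<bar>\<^sup>2" by simp
    also have "\<dots> < (real n + 1) * (\<bar>K\<bar> + 1)\<^sup>2"
      by (intro mult_strict_left_mono power_strict_mono) auto
    also have "\<dots> \<le> (real n + 1)\<^sup>2 * (\<bar>K\<bar> + 1)\<^sup>2"
      by (intro mult_right_mono) (auto simp: power2_eq_square algebra_simps)
    also have "\<dots> = R\<^sup>2" by (simp add: R_def power_mult_distrib)
    finally show False by simp
  qed
  have contP: "continuous_on X (\<lambda>z. P (f z) i)" if "i \<le> n" "continuous_on X f"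
    for X :: "(real \<times> (nat \<Rightarrow> real)) set" and f i
    by (rule continuous_on_compose2[OF cont[OF that(1)] that(2)]) auto
  have contx: "continuous_on X (\<lambda>z. snd z i :: real)" for X :: "(real \<times> (nat \<Rightarrow> real)) set" and i
    by (rule continuous_on_product_then_coordinatewise[OF continuous_on_snd[OF continuous_on_id]])
  have "homotopic_with_canon (\<lambda>_. True) S S
          (\<lambda>x. nrm (\<lambda>i. (1 - 0) * (R * x i) + 0 * P (\<lambda>i. R * x i) i))
          (\<lambda>x. nrm (\<lambda>i. (1 - 1) * (R * x i) + 1 * P (\<lambda>i. R * x i) i))"
    unfolding S_def nrm_def
    by (rule homotopic_on_sphere_normalized
          [where Q = "\<lambda>t x i. (1 - t) * (R * x i) + t * P (\<lambda>i. R * x i) i"])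
       (use out in \<open>auto intro!: continuous_intros contP contx simp: S_def\<close>)
  moreover have "nrm (\<lambda>i. (1 - 0) * (R * x i) + 0 * P (\<lambda>i. R * x i) i) = x" if "x \<in> S" for x
    using that \<open>R > 0\<close>
    by (auto simp: S_def nrm_def fun_eq_iff power_mult_distrib real_sqrt_mult simp flip: sum_distrib_left)
  ultimately have "homotopic_with_canon (\<lambda>_. True) S S id (\<lambda>x. nrm (P (\<lambda>i. R * x i)))"
    by (elim homotopic_with_eq) auto
  moreover
  have "homotopic_with_canon (\<lambda>_. True) S S (\<lambda>x. nrm (P (\<lambda>i. (1 - 0) * R * x i)))
          (\<lambda>x. nrm (P (\<lambda>i. (1 - 1) * R * x i)))"
    unfolding S_def nrm_def
    by (rule homotopic_on_sphere_normalized[where Q = "\<lambda>t x i. P (\<lambda>i. (1 - t) * R * x i) i"])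
       (use nz in \<open>auto intro!: continuous_intros contP contx simp: S_def\<close>)
  ultimately have "homotopic_with_canon (\<lambda>_. True) S S id (\<lambda>x. nrm (P (\<lambda>i. 0)))"
    by (simp add: homotopic_with_trans)
  then have "contractible_space (nsphere n)"
    unfolding contractible_space_def nsphere euclidean_product_topology S_def by blast
  then show False
    by (simp add: non_contractible_space_nsphere)
qed

section \<open>Periodic sequences and grid functions\<close>

text \<open>The value type is left open so that predicates are included: an equation between
  periodic sequences is a periodic family of truth values, and verifying it on one period verifies
  it on all integers.\<close>

definition periodic :: "nat \<Rightarrow> (int \<Rightarrow> 'a) set" where
  "periodic N = {a. \<forall>i. a (i + (int N + 1)) = a i}"

lemma per_mult_shift:
  assumes "a \<in> periodic N"
  shows "a (i + k * (int N + 1)) = a i"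
proof (induction k rule: int_induct[where k = 0])
  have M: "a (j + (int N + 1)) = a j" for j using assms unfolding periodic_def by blast
  {
    case (step1 k)
    then show ?case using M[of "i + k * (int N + 1)"] by (simp add: algebra_simps)
  next
    case (step2 k)
    then show ?case using M[of "i + (k - 1) * (int N + 1)"] by (simp add: algebra_simps)
  }
qed simp

lemma per_mod:
  assumes "a \<in> periodic N"
  shows "a (i mod (int N + 1)) = a i"
  using per_mult_shift[OF assms, of i "- (i div (int N + 1))"]
  by (simp add: minus_div_mult_eq_mod [symmetric])

lemma mod_in_range: "i mod (int N + 1) \<in> {0..int N}"
  using pos_mod_bound[of "int N + 1" i] pos_mod_sign[of "int N + 1" i] by simp

lemma per_ball_iff:
  assumes "P \<in> periodic N"
  shows "(\<forall>i\<in>{0..int N}. P i) \<longleftrightarrow> (\<forall>i. P i)"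
  by (metis assms mod_in_range per_mod)

lemma per_shift:
  assumes "a \<in> periodic N"
  shows "(\<lambda>i. a (i + k)) \<in> periodic N" "(\<lambda>i. a (i - k)) \<in> periodic N"
proof -
  have "i + (int N + 1) + k = (i + k) + (int N + 1)" "i + (int N + 1) - k = (i - k) + (int N + 1)" for i
    by simp_all
  then show "(\<lambda>i. a (i + k)) \<in> periodic N" "(\<lambda>i. a (i - k)) \<in> periodic N"
    using assms unfolding periodic_def mem_Collect_eq by metis+
qed

lemma per_const: "(\<lambda>i. c) \<in> periodic N"
  by (simp add: periodic_def)

lemma per_map: "a \<in> periodic N \<Longrightarrow> (\<lambda>i. f (a i)) \<in> periodic N"
  by (simp add: periodic_def)

lemma per_map2: "a \<in> periodic N \<Longrightarrow> b \<in> periodic N \<Longrightarrow> (\<lambda>i. f (a i) (b i)) \<in> periodic N"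
  by (simp add: periodic_def)

lemmas per_arith =
  per_shift per_const
  per_map2[where f = "(+) :: real \<Rightarrow> _"] per_map2[where f = "(-) :: real \<Rightarrow> _"]
  per_map2[where f = "(*) :: real \<Rightarrow> _"] per_map2[where f = "(/) :: real \<Rightarrow> _"]
  per_map2[where f = "(=) :: real \<Rightarrow> _"]
  per_map[where f = "uminus :: real \<Rightarrow> _"] per_map[where f = "abs :: real \<Rightarrow> _"]
  per_map[where f = "exp :: real \<Rightarrow> _"] per_map[where f = "\<lambda>x :: real. x ^ 2"]

lemma per_sum_shift:
  fixes a :: "int \<Rightarrow> real"
  assumes "a \<in> periodic N"
  shows "(\<Sum>i\<in>{0..int N}. a (i + 1)) = (\<Sum>i\<in>{0..int N}. a i)"
    and "(\<Sum>i\<in>{0..int N}. a (i - 1)) = (\<Sum>i\<in>{0..int N}. a i)"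
proof -
  have *: "(\<Sum>i\<in>{0..int N}. b (i + 1)) = (\<Sum>i\<in>{0..int N}. b i)" if b: "b \<in> periodic N"
    for b :: "int \<Rightarrow> real"
  proof -
    have "(\<Sum>i\<in>{0..int N}. b (i + 1)) = (\<Sum>i\<in>{1..int N + 1}. b i)"
      by (rule sum.reindex_bij_witness[of _ "\<lambda>i. i - 1" "\<lambda>i. i + 1"]) auto
    also have "{1..int N + 1} = insert (int N + 1) {1..int N}" by auto
    also have "(\<Sum>i\<in>insert (int N + 1) {1..int N}. b i) = b (0 + (int N + 1)) + (\<Sum>i\<in>{1..int N}. b i)"
      by simp
    also have "b (0 + (int N + 1)) = b 0" using b unfolding periodic_def by blast
    also have "b 0 + (\<Sum>i\<in>{1..int N}. b i) = (\<Sum>i\<in>insert 0 {1..int N}. b i)" by simp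
    also have "insert 0 {1..int N} = {0..int N}" by auto
    finally show ?thesis .
  qed
  show "(\<Sum>i\<in>{0..int N}. a (i + 1)) = (\<Sum>i\<in>{0..int N}. a i)" by (rule *[OF assms])
  show "(\<Sum>i\<in>{0..int N}. a (i - 1)) = (\<Sum>i\<in>{0..int N}. a i)"
    using *[OF per_shift(2)[OF assms, of 1]] by simp
qed

lemma per_sum_by_parts:
  fixes a b :: "int \<Rightarrow> real"
  assumes "a \<in> periodic N" "b \<in> periodic N"
  shows "(\<Sum>i\<in>{0..int N}. (a i - a (i - 1)) * b i) = - (\<Sum>i\<in>{0..int N}. a i * (b (i + 1) - b i))"
  using per_sum_shift(1)[of "\<lambda>i. a (i - 1) * b i" N] assms
  by (simp add: per_arith algebra_simps sum.distrib sum_subtractf)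

lemma per_sum_telescope:
  fixes a :: "int \<Rightarrow> real"
  assumes "a \<in> periodic N"
  shows "(\<Sum>i\<in>{0..int N}. a (i + 1) - a i) = 0" "(\<Sum>i\<in>{0..int N}. a i - a (i - 1)) = 0"
  using per_sum_shift[OF assms] by (simp_all add: sum_subtractf)

lemma per_second_difference_by_parts:
  fixes a b :: "int \<Rightarrow> real"
  assumes "a \<in> periodic N" "b \<in> periodic N"
  shows "(\<Sum>i\<in>{0..int N}. (a (i + 1) - 2 * a i + a (i - 1)) * b i)
         = - (\<Sum>i\<in>{0..int N}. (a (i + 1) - a i) * (b (i + 1) - b i))"
  using per_sum_by_parts[of "\<lambda>i. a (i + 1) - a i" N b] assms
  by (simp add: per_arith algebra_simps)

lemma per_obtains_max:
  fixes a :: "int \<Rightarrow> real"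
  assumes "a \<in> periodic N"
  obtains k where "k \<in> {0..int N}" "\<And>i. a i \<le> a k"
proof -
  have "Max (a ` {0..int N}) \<in> a ` {0..int N}" by (rule Max_in) auto
  then obtain k where "k \<in> {0..int N}" "Max (a ` {0..int N}) = a k" by blast
  then have "k \<in> {0..int N}" "\<And>i. i \<in> {0..int N} \<Longrightarrow> a i \<le> a k"
    by (metis Max_ge finite_atLeastAtMost_int finite_imageI imageI)+
  then show ?thesis
    using that by (metis assms mod_in_range per_mod)
qed

lemma per_obtains_min:
  fixes a :: "int \<Rightarrow> real"
  assumes "a \<in> periodic N"
  obtains k where "k \<in> {0..int N}" "\<And>i. a k \<le> a i"
  using per_obtains_max[of "\<lambda>i. - a i" N] assms by (metis neg_le_iff_le per_map)

text \<open>Applied three times: to the linear mass balance, to the Poisson equation, and to the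
  momentum equation. Periodic sequences have N + 1 free coordinates, so the sphere behind it has
  dimension N.\<close>

lemma per_zero_exists:
  fixes F :: "(int \<Rightarrow> real) \<Rightarrow> int \<Rightarrow> real"
  assumes cont: "\<And>i. i \<in> {0..int N} \<Longrightarrow> continuous_on (periodic N) (\<lambda>x. F x i)"
    and bound: "\<And>t x i. \<lbrakk>x \<in> periodic N; 0 \<le> t; t \<le> 1;
        \<And>i. i \<in> {0..int N} \<Longrightarrow> (1 - t) * x i + t * F x i = 0; i \<in> {0..int N}\<rbrakk> \<Longrightarrow> \<bar>x i\<bar> \<le> K"
  shows "\<exists>x\<in>periodic N. \<forall>i\<in>{0..int N}. F x i = 0"
proof -
  define E where "E x = (\<lambda>i. x (nat (i mod (int N + 1))))" for x :: "nat \<Rightarrow> real"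
  have E: "E x \<in> periodic N" for x by (simp add: E_def periodic_def)
  have Ei: "E x (int k) = x k" if "k \<le> N" for x k
    using that by (simp add: E_def zmod_int flip: of_nat_Suc)
  have cE: "continuous_on UNIV E"
    unfolding E_def by (intro continuous_on_coordinatewise_then_product continuous_on_product_coordinates)
  have "\<exists>x. \<forall>k\<le>N. F (E x) (int k) = 0"
  proof (rule leray_schauder_zero[where K = K])
    fix k assume "k \<le> N"
    show "continuous_on UNIV (\<lambda>x. F (E x) (int k))"
      by (rule continuous_on_compose2[OF cont cE]) (use E \<open>k \<le> N\<close> in auto)
  next
    fix t :: real and x k
    assume t: "0 \<le> t" "t \<le> 1" and "k \<le> N"
      and eq: "\<And>k. k \<le> N \<Longrightarrow> (1 - t) * x k + t * F (E x) (int k) = 0"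
    have "(1 - t) * E x i + t * F (E x) i = 0" if "i \<in> {0..int N}" for i
      using eq[of "nat i"] Ei[of "nat i" x] that by (simp add: nat_le_iff)
    from bound[OF E t this, of "int k"] show "\<bar>x k\<bar> \<le> K"
      using \<open>k \<le> N\<close> Ei by simp
  qed
  then obtain x where x: "\<forall>k\<le>N. F (E x) (int k) = 0" by blast
  have "F (E x) i = 0" if "i \<in> {0..int N}" for i
    using x[rule_format, of "nat i"] that by (simp add: nat_le_iff)
  then show ?thesis using E by blast
qed

section \<open>Cells, piecewise constant functions and their integrals\<close>

lemma dx_pos: "dx N > 0"
  by (simp add: dx_def add_nonneg_pos)

lemma dx_mult: "dx N * (real N + 1) = 1" "(real N + 1) * dx N = 1"
  by (simp_all add: dx_def add_nonneg_pos order_less_imp_not_eq2)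

lemma mult_dx_le_iff: "a * dx N \<le> x \<longleftrightarrow> a \<le> x * (real N + 1)"
  and less_mult_dx_iff: "x < a * dx N \<longleftrightarrow> x * (real N + 1) < a"
  by (simp_all add: dx_def field_simps add_nonneg_pos)

lemma sum_dx: "(\<Sum>i\<in>{0..int N}. c * dx N) = c"
  using dx_mult[of N] by (simp add: algebra_simps)

lemma primal_pt_shift: "primal_pt N (i + k * (int N + 1)) = primal_pt N i + of_int k"
proof -
  have "primal_pt N (i + k * (int N + 1)) = primal_pt N i + of_int k * ((real N + 1) * dx N)"
    by (simp add: primal_pt_def algebra_simps)
  then show ?thesis by (simp add: dx_mult)
qed

lemma dual_pt_shift: "dual_pt N (i + k * (int N + 1)) = dual_pt N i + of_int k"
  by (simp add: dual_pt_def primal_pt_shift)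

lemma torus_fun_int: "torus_fun v \<Longrightarrow> v (x + of_int k) = v x"
proof (induction k rule: int_induct[where k = 0])
  case (step1 k)
  then show ?case unfolding torus_fun_def by (metis add.assoc of_int_1 of_int_add)
next
  case (step2 k)
  then show ?case unfolding torus_fun_def
    by (metis add.assoc diff_add_cancel of_int_1 of_int_add)
qed simp

lemma pval_per: "v \<in> X_primal N \<Longrightarrow> pval N v \<in> periodic N"
  using primal_pt_shift[of N _ 1] torus_fun_int[of v _ 1]
  by (auto simp: periodic_def pval_def X_primal_def)

lemma dval_per: "v \<in> X_dual N \<Longrightarrow> dval N v \<in> periodic N"
  using dual_pt_shift[of N _ 1] torus_fun_int[of v _ 1]
  by (auto simp: periodic_def dval_def X_dual_def)

text \<open>Half-open cells are fibres of a floor function, the summand 1/2 rounding to the nearest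
  grid index. Disjointness and covering of the cells then come for free.\<close>

lemma in_primal_cell_iff: "x \<in> primal_cell N i \<longleftrightarrow> \<lfloor>x * (real N + 1) + 1 / 2\<rfloor> = i"
proof -
  have "\<lfloor>x * (real N + 1) + 1 / 2\<rfloor> = i \<longleftrightarrow>
        of_int i - 1 / 2 \<le> x * (real N + 1) \<and> x * (real N + 1) < of_int i + 1 / 2"
    by (simp add: floor_eq_iff algebra_simps) linarith
  also have "\<dots> \<longleftrightarrow> x \<in> primal_cell N i"
    unfolding mult_dx_le_iff[symmetric] less_mult_dx_iff[symmetric]
    by (simp add: primal_cell_def primal_pt_def algebra_simps)
  finally show ?thesis by blast
qed

lemma in_dual_cell_iff: "x \<in> dual_cell N i \<longleftrightarrow> \<lfloor>x * (real N + 1)\<rfloor> = i"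
proof -
  have "\<lfloor>x * (real N + 1)\<rfloor> = i \<longleftrightarrow>
        of_int i \<le> x * (real N + 1) \<and> x * (real N + 1) < of_int i + 1"
    by (simp add: floor_eq_iff)
  also have "\<dots> \<longleftrightarrow> x \<in> dual_cell N i"
    unfolding mult_dx_le_iff[symmetric] less_mult_dx_iff[symmetric]
    by (simp add: dual_cell_def dual_pt_def primal_pt_def algebra_simps)
  finally show ?thesis by blast
qed

lemma primal_pt_in_cell: "primal_pt N i \<in> primal_cell N i"
  using dx_pos[of N] by (simp add: primal_cell_def)

lemma dual_pt_in_cell: "dual_pt N i \<in> dual_cell N i"
  using dx_pos[of N] by (simp add: dual_cell_def)

definition plift :: "nat \<Rightarrow> (int \<Rightarrow> real) \<Rightarrow> real \<Rightarrow> real" where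
  "plift N a x = a \<lfloor>x * (real N + 1) + 1 / 2\<rfloor>"

definition dlift :: "nat \<Rightarrow> (int \<Rightarrow> real) \<Rightarrow> real \<Rightarrow> real" where
  "dlift N a x = a \<lfloor>x * (real N + 1)\<rfloor>"

lemma pval_plift [simp]: "pval N (plift N a) i = a i"
  using primal_pt_in_cell[of N i] unfolding in_primal_cell_iff by (simp add: pval_def plift_def)

lemma dval_dlift [simp]: "dval N (dlift N a) i = a i"
  using dual_pt_in_cell[of N i] unfolding in_dual_cell_iff by (simp add: dval_def dlift_def)

lemma plift_in_X: 
  assumes "a \<in> periodic N"
  shows "plift N a \<in> X_primal N"
proof -
  have "\<lfloor>(x + 1) * (real N + 1) + 1 / 2\<rfloor> = \<lfloor>x * (real N + 1) + 1 / 2\<rfloor> + (int N + 1)" for x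
  proof -
    have "(x + 1) * (real N + 1) + 1 / 2 = (x * (real N + 1) + 1 / 2) + of_int (int N + 1)"
      by (simp add: algebra_simps)
    then show ?thesis by (simp only: floor_add_int)
  qed
  then show ?thesis
    using assms by (auto simp: X_primal_def torus_fun_def plift_def periodic_def constant_on_def in_primal_cell_iff)
qed

lemma dlift_in_X: 
  assumes "a \<in> periodic N"
  shows "dlift N a \<in> X_dual N"
proof -
  have "\<lfloor>(x + 1) * (real N + 1)\<rfloor> = \<lfloor>x * (real N + 1)\<rfloor> + (int N + 1)" for x
  proof -
    have "(x + 1) * (real N + 1) = (x * (real N + 1)) + of_int (int N + 1)"
      by (simp add: algebra_simps)
    then show ?thesis by (simp only: floor_add_int)
  qed
  then show ?thesis
    using assms by (auto simp: X_dual_def torus_fun_def dlift_def periodic_def constant_on_def in_dual_cell_iff)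
qed

text \<open>Membership in \<open>X_primal\<close> speaks of the cells 0 to N only. A point of any
  other cell is moved there by an integer translation, which changes its cell index by a multiple of
  N + 1.\<close>

lemma X_primal_eq:
  assumes "v \<in> X_primal N"
  shows "v x = pval N v \<lfloor>x * (real N + 1) + 1 / 2\<rfloor>"
proof -
  define j where "j = \<lfloor>x * (real N + 1) + 1 / 2\<rfloor>"
  define i where "i = j mod (int N + 1)"
  define q where "q = j div (int N + 1)"
  have ji: "i = j + (- q) * (int N + 1)"
    by (simp add: i_def q_def minus_div_mult_eq_mod [symmetric])
  have "(x + of_int (- q)) * (real N + 1) + 1 / 2 = (x * (real N + 1) + 1 / 2) + of_int ((- q) * (int N + 1))"
    by (simp add: algebra_simps)
  then have "\<lfloor>(x + of_int (- q)) * (real N + 1) + 1 / 2\<rfloor> = j + (- q) * (int N + 1)"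
    by (simp only: floor_add_int j_def)
  then have "x + of_int (- q) \<in> primal_cell N i"
    unfolding in_primal_cell_iff ji by blast
  moreover have "v constant_on primal_cell N i"
    using assms mod_in_range[of j N] by (auto simp: X_primal_def i_def)
  ultimately have "v (x + of_int (- q)) = v (primal_pt N i)"
    using primal_pt_in_cell[of N i] by (auto simp: constant_on_def)
  moreover have tf: "torus_fun v" using assms by (simp add: X_primal_def)
  ultimately have "v x = pval N v i"
    using torus_fun_int[OF tf, of x "- q"] by (simp add: pval_def)
  also have "\<dots> = pval N v j"
    unfolding i_def using per_mod[OF pval_per[OF assms]] .
  finally show ?thesis by (simp add: j_def)
qed

lemma X_primal_map: "v \<in> X_primal N \<Longrightarrow> (\<lambda>x. f (v x)) \<in> X_primal N"
  unfolding X_primal_def torus_fun_def constant_on_def by fastforce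

text \<open>Primal cells do not tile [0,1), since cell 0 straddles the origin. The interval is cut
  into half cells instead: \<open>?A i\<close> lies to the right of grid point i,
  \<open>?B i\<close> to the left of grid point i + 1. Periodicity then shifts the second family of
  contributions back by one index.\<close>

lemma integral_X_primal:
  assumes w: "w \<in> X_primal N"
  shows "(LINT x:{0..<1}|lebesgue. w x) = (\<Sum>i\<in>{0..int N}. pval N w i * dx N)"
proof -
  let ?A = "\<lambda>i. {of_int i * dx N ..< of_int i * dx N + dx N / 2}"
  let ?B = "\<lambda>i. {of_int i * dx N + dx N / 2 ..< of_int (i + 1) * dx N}"
  let ?p = "pval N w"
  have A: "x \<in> ?A i \<longleftrightarrow> of_int i \<le> x * (real N + 1) \<and> x * (real N + 1) < of_int i + 1 / 2" for x i
    unfolding mult_dx_le_iff[symmetric] less_mult_dx_iff[symmetric] by (simp add: algebra_simps)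
  have B: "x \<in> ?B i \<longleftrightarrow> of_int i + 1 / 2 \<le> x * (real N + 1) \<and> x * (real N + 1) < of_int i + 1" for x i
    unfolding mult_dx_le_iff[symmetric] less_mult_dx_iff[symmetric] by (simp add: algebra_simps)
  have eq: "indicat_real {0..<1} x *\<^sub>R w x
        = (\<Sum>i\<in>{0..int N}. ?p i * indicat_real (?A i) x + ?p (i + 1) * indicat_real (?B i) x)" for x
  proof -
    define k where "k = \<lfloor>x * (real N + 1)\<rfloor>"
    have k: "of_int k \<le> x * (real N + 1)" "x * (real N + 1) < of_int k + 1"
      by (simp_all add: k_def)
    have uniq: "i = k" if "of_int i \<le> x * (real N + 1)" "x * (real N + 1) < of_int i + 1" for i
      using floor_unique[OF that] by (simp add: k_def)
    have "?p i * indicat_real (?A i) x + ?p (i + 1) * indicat_real (?B i) x = (if i = k then w x else 0)" for i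
    proof (cases "i = k")
      case True
      show ?thesis
      proof (cases "x * (real N + 1) < of_int k + 1 / 2")
        case h: True
        then have "\<lfloor>x * (real N + 1) + 1 / 2\<rfloor> = k" using k by (simp add: floor_eq_iff)
        then have "w x = ?p k" using X_primal_eq[OF w, of x] by simp
        moreover have "x \<in> ?A k" "x \<notin> ?B k" unfolding A B using k h by auto
        ultimately show ?thesis using True by simp
      next
        case h: False
        then have "\<lfloor>x * (real N + 1) + 1 / 2\<rfloor> = k + 1" using k by (simp add: floor_eq_iff)
        then have "w x = ?p (k + 1)" using X_primal_eq[OF w, of x] by simp
        moreover have "x \<notin> ?A k" "x \<in> ?B k" unfolding A B using k h by auto
        ultimately show ?thesis using True by simp
      qed
    next
      case False
      then have "x \<notin> ?A i" "x \<notin> ?B i" unfolding A B using uniq[of i] by auto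
      with False show ?thesis by simp
    qed
    then have "(\<Sum>i\<in>{0..int N}. ?p i * indicat_real (?A i) x + ?p (i + 1) * indicat_real (?B i) x)
               = (if k \<in> {0..int N} then w x else 0)"
      by simp
    also have "k \<in> {0..int N} \<longleftrightarrow> x \<in> {0..<1}"
    proof -
      have "0 \<le> k \<longleftrightarrow> 0 \<le> x * (real N + 1)" by (simp add: k_def)
      moreover have "k \<le> int N \<longleftrightarrow> x * (real N + 1) < real N + 1" by (simp add: k_def floor_le_iff)
      ultimately show ?thesis by (simp add: zero_le_mult_iff)
    qed
    finally show ?thesis by simp
  qed
  have "has_bochner_integral lebesgue
          (\<lambda>x. \<Sum>i\<in>{0..int N}. ?p i * indicat_real (?A i) x + ?p (i + 1) * indicat_real (?B i) x)
          (\<Sum>i\<in>{0..int N}. ?p i * measure lebesgue (?A i) + ?p (i + 1) * measure lebesgue (?B i))"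
    by (intro has_bochner_integral_sum has_bochner_integral_add has_bochner_integral_mult_right
          has_bochner_integral_real_indicator) (auto simp: algebra_simps less_imp_le[OF dx_pos])
  then have "(LINT x:{0..<1}|lebesgue. w x)
       = (\<Sum>i\<in>{0..int N}. ?p i * measure lebesgue (?A i) + ?p (i + 1) * measure lebesgue (?B i))"
    unfolding set_lebesgue_integral_def eq by (rule has_bochner_integral_integral_eq)
  also have "\<dots> = (\<Sum>i\<in>{0..int N}. ?p i * (dx N / 2) + ?p (i + 1) * (dx N / 2))"
    using dx_pos[of N] by (simp add: algebra_simps)
  also have "\<dots> = (\<Sum>i\<in>{0..int N}. ?p i * dx N)"
    using per_sum_shift(1)[OF per_map[OF pval_per[OF w], of "\<lambda>y. y * (dx N / 2)"]]
    by (simp add: sum.distrib sum_distrib_left)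
  finally show ?thesis .
qed

lemma Lp_norm_X_primal:
  assumes "v \<in> X_primal N"
  shows "Lp_norm p v = (\<Sum>i\<in>{0..int N}. \<bar>pval N v i\<bar> powr p * dx N) powr (1 / p)"
  unfolding Lp_norm_def
  using integral_X_primal[OF X_primal_map[OF assms, of "\<lambda>y. \<bar>y\<bar> powr p"]] by (simp add: pval_def)

section \<open>Implicit mass balance\<close>

text \<open>Yields continuity of implicitly defined solutions from a stability estimate alone: the
  bound \<open>B w z\<close> has to be continuous in z and to vanish at z = w, with no formula for
  the solution.\<close>

lemma continuous_on_by_modulus:
  fixes f :: "'a :: topological_space \<Rightarrow> real"
  assumes cont: "\<And>w. w \<in> Z \<Longrightarrow> continuous_on Z (B w)"
    and zero: "\<And>w. w \<in> Z \<Longrightarrow> B w w = 0"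
    and le: "\<And>w z. w \<in> Z \<Longrightarrow> z \<in> Z \<Longrightarrow> \<bar>f z - f w\<bar> \<le> B w z"
  shows "continuous_on Z f"
  unfolding continuous_on_def
proof
  fix w assume w: "w \<in> Z"
  have "((\<lambda>z. f z - f w) \<longlongrightarrow> 0) (at w within Z)"
  proof (rule Lim_null_comparison)
    show "\<forall>\<^sub>F z in at w within Z. norm (f z - f w) \<le> B w z"
      using le w by (simp add: eventually_at_filter)
    show "(B w \<longlongrightarrow> 0) (at w within Z)"
      using cont[OF w] w zero[OF w] unfolding continuous_on_def by metis
  qed
  then show "(f \<longlongrightarrow> f w) (at w within Z)" by (rule LIM_zero_cancel)
qed

lemma continuous_on_per_coordinate: "continuous_on Z (\<lambda>x. x i :: real)"
  by (rule continuous_on_subset[OF continuous_on_product_coordinates]) auto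

text \<open>
  The implicit mass balance reads \<open>upwind_op a b x = \<rho>\<close> with \<open>a = \<Delta>t/\<Delta>x g(u)\<close> and
  \<open>b = \<Delta>t/\<Delta>x (g(u) - u)\<close>: an M-matrix all of whose columns sum to 1.
\<close>

definition upwind_op :: "(int \<Rightarrow> real) \<Rightarrow> (int \<Rightarrow> real) \<Rightarrow> (int \<Rightarrow> real) \<Rightarrow> int \<Rightarrow> real" where
  "upwind_op a b x i = (1 + a i + b (i - 1)) * x i - b i * x (i + 1) - a (i - 1) * x (i - 1)"

lemma upwind_op_per:
  "a \<in> periodic N \<Longrightarrow> b \<in> periodic N \<Longrightarrow> x \<in> periodic N \<Longrightarrow> upwind_op a b x \<in> periodic N"
  unfolding upwind_op_def[abs_def] by (simp add: per_arith)

lemma sum_upwind_op: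
  assumes "a \<in> periodic N" "b \<in> periodic N" "x \<in> periodic N"
  shows "(\<Sum>i\<in>{0..int N}. upwind_op a b x i) = (\<Sum>i\<in>{0..int N}. x i)"
proof -
  have "(\<Sum>i\<in>{0..int N}. b i * x (i + 1)) = (\<Sum>i\<in>{0..int N}. b (i - 1) * x i)"
    using per_sum_shift(1)[of "\<lambda>i. b (i - 1) * x i" N] assms by (simp add: per_arith)
  moreover have "(\<Sum>i\<in>{0..int N}. a (i - 1) * x (i - 1)) = (\<Sum>i\<in>{0..int N}. a i * x i)"
    using per_sum_shift(2)[of "\<lambda>i. a i * x i" N] assms by (simp add: per_arith)
  ultimately show ?thesis
    by (simp add: upwind_op_def algebra_simps sum.distrib sum_subtractf)
qed

text \<open>Off-diagonal coefficients are nonpositive, so passing to absolute values inside the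
  operator can only lower it below |\<open>upwind_op a b x i\<close>|. Summation over i then uses
  the unit column sums. In particular the inverse has l1 norm at most 1.\<close>

lemma upwind_op_l1_expansive:
  assumes per: "a \<in> periodic N" "b \<in> periodic N" "x \<in> periodic N"
    and nonneg: "\<And>i. a i \<ge> 0" "\<And>i. b i \<ge> 0"
  shows "(\<Sum>i\<in>{0..int N}. \<bar>x i\<bar>) \<le> (\<Sum>i\<in>{0..int N}. \<bar>upwind_op a b x i\<bar>)"
proof -
  have "upwind_op a b (\<lambda>i. \<bar>x i\<bar>) i \<le> \<bar>upwind_op a b x i\<bar>" for i
  proof -
    have "(1 + a i + b (i - 1)) * \<bar>x i\<bar> = \<bar>(1 + a i + b (i - 1)) * x i\<bar>"
      "b i * \<bar>x (i + 1)\<bar> = \<bar>b i * x (i + 1)\<bar>" "a (i - 1) * \<bar>x (i - 1)\<bar> = \<bar>a (i - 1) * x (i - 1)\<bar>"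
      using nonneg by (simp_all add: abs_mult)
    then show ?thesis unfolding upwind_op_def by linarith
  qed
  then have "(\<Sum>i\<in>{0..int N}. upwind_op a b (\<lambda>i. \<bar>x i\<bar>) i) \<le> (\<Sum>i\<in>{0..int N}. \<bar>upwind_op a b x i\<bar>)"
    by (rule sum_mono)
  then show ?thesis
    using sum_upwind_op[of a N b "\<lambda>i. \<bar>x i\<bar>"] per by (simp add: per_arith)
qed

text \<open>For a positive right-hand side, l1 expansivity and conservation of the sum force the sum
  of |x i| - x i to be at most 0, hence x \<ge> 0. Dropping the off-diagonal terms then gives the
  quantitative bound, and strictness with it.\<close>

lemma upwind_op_positive:
  assumes per: "a \<in> periodic N" "b \<in> periodic N" "x \<in> periodic N"
    and nonneg: "\<And>i. a i \<ge> 0" "\<And>i. b i \<ge> 0"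
    and pos: "\<And>i. upwind_op a b x i > 0"
  shows "x i > 0" and "(1 + a i + b (i - 1)) * x i \<ge> upwind_op a b x i"
proof -
  have "(\<Sum>i\<in>{0..int N}. \<bar>x i\<bar> - x i) \<le> 0"
    using upwind_op_l1_expansive[OF per nonneg] sum_upwind_op[OF per] pos
    by (simp add: sum_subtractf less_imp_le)
  then have "(\<Sum>i\<in>{0..int N}. \<bar>x i\<bar> - x i) = 0"
    by (intro antisym sum_nonneg) auto
  then have "\<forall>i\<in>{0..int N}. \<bar>x i\<bar> - x i = 0"
    by (subst (asm) sum_nonneg_eq_0_iff) auto
  then have "\<forall>i. \<bar>x i\<bar> - x i = 0"
    by (subst (asm) per_ball_iff) (simp add: per_arith per)
  then have x0: "x i \<ge> 0" for i by (metis abs_ge_zero eq_iff_diff_eq_0)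
  then show le: "(1 + a i + b (i - 1)) * x i \<ge> upwind_op a b x i" for i
    using mult_nonneg_nonneg[OF nonneg(1)[of "i - 1"] x0[of "i - 1"]]
      mult_nonneg_nonneg[OF nonneg(2)[of i] x0[of "i + 1"]] by (simp add: upwind_op_def)
  show "x i > 0"
    using le[of i] pos[of i] x0[of i] by (cases "x i = 0") auto
qed

text \<open>The homotopy to the identity stays within the class: it is the same operator with
  coefficients t a and t b and right-hand side t r. The l1 bound is therefore uniform in t.\<close>

lemma upwind_op_surj:
  assumes per: "a \<in> periodic N" "b \<in> periodic N" "r \<in> periodic N"
    and nonneg: "\<And>i. a i \<ge> 0" "\<And>i. b i \<ge> 0"
  shows "\<exists>x\<in>periodic N. \<forall>i. upwind_op a b x i = r i"
proof -
  have "\<exists>x\<in>periodic N. \<forall>i\<in>{0..int N}. upwind_op a b x i - r i = 0"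
  proof (rule per_zero_exists[where K = "\<Sum>i\<in>{0..int N}. \<bar>r i\<bar>"])
    show "continuous_on (periodic N) (\<lambda>x. upwind_op a b x i - r i)" for i
      unfolding upwind_op_def by (intro continuous_intros continuous_on_per_coordinate)
  next
    fix t :: real and x i
    assume x: "x \<in> periodic N" and t: "0 \<le> t" "t \<le> 1" and i: "i \<in> {0..int N}"
      and eq: "\<And>i. i \<in> {0..int N} \<Longrightarrow> (1 - t) * x i + t * (upwind_op a b x i - r i) = 0"
    have eq': "upwind_op (\<lambda>i. t * a i) (\<lambda>i. t * b i) x i = t * r i" if "i \<in> {0..int N}" for i
      using eq[OF that] by (simp add: upwind_op_def algebra_simps)
    have "\<bar>x i\<bar> \<le> (\<Sum>i\<in>{0..int N}. \<bar>x i\<bar>)"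
      using i by (intro member_le_sum) auto
    also have "\<dots> \<le> (\<Sum>i\<in>{0..int N}. \<bar>upwind_op (\<lambda>i. t * a i) (\<lambda>i. t * b i) x i\<bar>)"
      using per x t nonneg by (intro upwind_op_l1_expansive) (auto simp: per_arith)
    also have "\<dots> \<le> (\<Sum>i\<in>{0..int N}. \<bar>r i\<bar>)"
      using t eq' by (intro sum_mono) (simp add: abs_mult mult_left_le_one_le)
    finally show "\<bar>x i\<bar> \<le> (\<Sum>i\<in>{0..int N}. \<bar>r i\<bar>)" .
  qed
  then obtain x where x: "x \<in> periodic N" "\<forall>i\<in>{0..int N}. upwind_op a b x i = r i" by auto
  then have "\<forall>i. upwind_op a b x i = r i"
    using per by (subst (asm) per_ball_iff) (auto simp: per_arith upwind_op_per)
  with x show ?thesis by blast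
qed

text \<open>The difference of the solutions at z and w solves the system at z, with the residual of
  the solution at w as right-hand side. That residual is explicit in the coefficients and vanishes
  at z = w.\<close>

lemma upwind_op_solution_continuous:
  fixes a b x :: "'z :: topological_space \<Rightarrow> int \<Rightarrow> real"
  assumes per: "\<And>z. z \<in> Z \<Longrightarrow> a z \<in> periodic N" "\<And>z. z \<in> Z \<Longrightarrow> b z \<in> periodic N"
      "\<And>z. z \<in> Z \<Longrightarrow> x z \<in> periodic N"
    and nonneg: "\<And>z i. z \<in> Z \<Longrightarrow> a z i \<ge> 0" "\<And>z i. z \<in> Z \<Longrightarrow> b z i \<ge> 0"
    and cont: "\<And>i. continuous_on Z (\<lambda>z. a z i)" "\<And>i. continuous_on Z (\<lambda>z. b z i)"
    and eq: "\<And>z i. z \<in> Z \<Longrightarrow> upwind_op (a z) (b z) (x z) i = r i"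
  shows "continuous_on Z (\<lambda>z. x z i)"
proof -
  have mod: "continuous_on Z (\<lambda>z. x z k)" if k: "k \<in> {0..int N}" for k
  proof (rule continuous_on_by_modulus
      [where B = "\<lambda>w z. \<Sum>j\<in>{0..int N}. \<bar>r j - upwind_op (a z) (b z) (x w) j\<bar>"])
    fix w assume w: "w \<in> Z"
    show "continuous_on Z (\<lambda>z. \<Sum>j\<in>{0..int N}. \<bar>r j - upwind_op (a z) (b z) (x w) j\<bar>)"
      unfolding upwind_op_def by (intro continuous_intros cont)
    show "(\<Sum>j\<in>{0..int N}. \<bar>r j - upwind_op (a w) (b w) (x w) j\<bar>) = 0"
      using eq[OF w] by simp
    fix z assume z: "z \<in> Z"
    have "\<bar>x z k - x w k\<bar> \<le> (\<Sum>j\<in>{0..int N}. \<bar>x z j - x w j\<bar>)"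
      using k by (intro member_le_sum[where f = "\<lambda>j. \<bar>x z j - x w j\<bar>"]) auto
    also have "\<dots> \<le> (\<Sum>j\<in>{0..int N}. \<bar>upwind_op (a z) (b z) (\<lambda>j. x z j - x w j) j\<bar>)"
      using per z w nonneg by (intro upwind_op_l1_expansive) (auto simp: per_arith)
    also have "\<dots> = (\<Sum>j\<in>{0..int N}. \<bar>r j - upwind_op (a z) (b z) (x w) j\<bar>)"
      using eq[OF z] by (intro sum.cong refl) (simp add: upwind_op_def algebra_simps)
    finally show "\<bar>x z k - x w k\<bar> \<le> (\<Sum>j\<in>{0..int N}. \<bar>r j - upwind_op (a z) (b z) (x w) j\<bar>)" .
  qed
  show ?thesis
    using mod[OF mod_in_range[of i N]] per(3)
    by (subst continuous_on_cong[OF refl, where g = "\<lambda>z. x z (i mod (int N + 1))"])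
       (auto simp: per_mod)
qed

section \<open>Discrete Poisson equation\<close>

definition poisson_seq :: "real \<Rightarrow> (int \<Rightarrow> real) \<Rightarrow> (int \<Rightarrow> real) \<Rightarrow> bool" where
  "poisson_seq c r f \<longleftrightarrow> (\<forall>i. c * (f (i + 1) - 2 * f i + f (i - 1)) + exp (- f i) = r i)"

text \<open>Discrete maximum principle: the second difference is nonpositive where f is largest and
  nonnegative where f is smallest.\<close>

lemma poisson_seq_bounds:
  assumes "c \<ge> 0" "f \<in> periodic N" "poisson_seq c r f"
  obtains k l where "k \<in> {0..int N}" "\<And>i. r k \<le> exp (- f i)"
    and "l \<in> {0..int N}" "\<And>i. exp (- f i) \<le> r l"
proof -
  obtain k where k: "k \<in> {0..int N}" "\<And>i. f i \<le> f k" using per_obtains_max assms by blast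
  obtain l where l: "l \<in> {0..int N}" "\<And>i. f l \<le> f i" using per_obtains_min assms by blast
  have "f (k + 1) - 2 * f k + f (k - 1) \<le> 0" using k(2)[of "k + 1"] k(2)[of "k - 1"] by simp
  then have "c * (f (k + 1) - 2 * f k + f (k - 1)) \<le> 0" using \<open>c \<ge> 0\<close> by (simp add: mult_nonneg_nonpos)
  then have "r k \<le> exp (- f k)" using assms(3) unfolding poisson_seq_def by (metis add_le_same_cancel2)
  then have "r k \<le> exp (- f i)" for i by (rule order_trans) (simp add: k)
  moreover
  have "f (l + 1) - 2 * f l + f (l - 1) \<ge> 0" using l(2)[of "l + 1"] l(2)[of "l - 1"] by simp
  then have "c * (f (l + 1) - 2 * f l + f (l - 1)) \<ge> 0" using \<open>c \<ge> 0\<close> by simp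
  then have "exp (- f l) \<le> r l" using assms(3) unfolding poisson_seq_def by (metis le_add_same_cancel2)
  then have "exp (- f i) \<le> r l" for i by (rule order_trans[rotated]) (simp add: l)
  ultimately show ?thesis using that k l by blast
qed

text \<open>The residual is written as datum minus operator, so that it pulls in the same direction
  as the identity: at a maximum of f above \<open>?K\<close> neither summand of the homotopy is
  negative and one is positive, and symmetrically at a minimum below \<open>- ?K\<close>. The level
  comes from exp (- f) = r, that is f = - ln r.\<close>

lemma poisson_seq_exists:
  assumes c: "c \<ge> 0" and r: "r \<in> periodic N" and pos: "\<And>i. r i > 0"
  shows "\<exists>f\<in>periodic N. poisson_seq c r f"
proof -
  let ?D = "\<lambda>f i. f (i + 1) - 2 * f i + f (i - 1) :: real"
  let ?K = "\<Sum>i\<in>{0..int N}. \<bar>ln (r i)\<bar>"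
  have "\<exists>f\<in>periodic N. \<forall>i\<in>{0..int N}. r i - (c * ?D f i + exp (- f i)) = 0"
  proof (rule per_zero_exists[where K = ?K])
    show "continuous_on (periodic N) (\<lambda>f. r i - (c * ?D f i + exp (- f i)))" for i
      by (intro continuous_intros continuous_on_per_coordinate)
  next
    fix t :: real and f i
    assume f: "f \<in> periodic N" and t: "0 \<le> t" "t \<le> 1"
      and eq: "\<And>i. i \<in> {0..int N} \<Longrightarrow> (1 - t) * f i + t * (r i - (c * ?D f i + exp (- f i))) = 0"
    have lnK: "\<bar>ln (r i)\<bar> \<le> ?K" if "i \<in> {0..int N}" for i
      using that by (intro member_le_sum[where f = "\<lambda>i. \<bar>ln (r i)\<bar>"]) auto
    have K0: "?K \<ge> 0" by (simp add: sum_nonneg)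
    obtain k where k: "k \<in> {0..int N}" "\<And>i. f i \<le> f k" using per_obtains_max f by blast
    obtain l where l: "l \<in> {0..int N}" "\<And>i. f l \<le> f i" using per_obtains_min f by blast
    have "f k \<le> ?K"
    proof (rule ccontr)
      assume "\<not> f k \<le> ?K"
      then have "f k > 0" "- f k < ln (r k)" using lnK[OF k(1)] K0 by auto
      then have "exp (- f k) < r k" using pos by (metis exp_less_mono exp_ln)
      moreover have "?D f k \<le> 0" using k(2)[of "k + 1"] k(2)[of "k - 1"] by simp
      then have "c * ?D f k \<le> 0" using c by (simp add: mult_nonneg_nonpos)
      ultimately have p: "r k - (c * ?D f k + exp (- f k)) > 0" by linarith
      have "(1 - t) * f k + t * (r k - (c * ?D f k + exp (- f k))) > 0"
      proof (cases "t = 0")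
        case False
        then show ?thesis using t \<open>f k > 0\<close> p by (intro add_nonneg_pos mult_pos_pos) auto
      qed (use \<open>f k > 0\<close> in simp)
      then show False using eq[OF k(1)] by simp
    qed
    moreover have "- f l \<le> ?K"
    proof (rule ccontr)
      assume "\<not> - f l \<le> ?K"
      then have "f l < 0" "- f l > ln (r l)" using lnK[OF l(1)] K0 by auto
      then have "exp (- f l) > r l" using pos by (metis exp_less_mono exp_ln)
      moreover have "?D f l \<ge> 0" using l(2)[of "l + 1"] l(2)[of "l - 1"] by simp
      then have "c * ?D f l \<ge> 0" using c by simp
      ultimately have p: "r l - (c * ?D f l + exp (- f l)) < 0" by linarith
      have "(1 - t) * f l + t * (r l - (c * ?D f l + exp (- f l))) < 0"
      proof (cases "t = 0")
        case False
        then show ?thesis using t \<open>f l < 0\<close> p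
          by (intro add_nonpos_neg mult_pos_neg mult_nonneg_nonpos) auto
      qed (use \<open>f l < 0\<close> in simp)
      then show False using eq[OF l(1)] by simp
    qed
    ultimately show "\<bar>f i\<bar> \<le> ?K" using k(2)[of i] l(2)[of i] by linarith
  qed
  then obtain f where f: "f \<in> periodic N" "\<forall>i\<in>{0..int N}. c * ?D f i + exp (- f i) = r i" by auto
  then have "\<forall>i. c * ?D f i + exp (- f i) = r i"
    using r by (subst (asm) per_ball_iff) (auto simp: per_arith)
  with f show ?thesis by (auto simp: poisson_seq_def)
qed

text \<open>Comparison at the index k where f - h is largest: the second difference has a sign
  there, so exp (- h k) - exp (- f k) is at most the difference of the data. By convexity of exp it
  is at least exp (- f k) (f k - h k), and the maximum principle gives exp (- f k) \<ge> r
  m.\<close>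

lemma poisson_seq_stability:
  assumes c: "c \<ge> 0" and per: "f \<in> periodic N" "h \<in> periodic N" and pos: "\<And>i. r i > 0"
    and f: "poisson_seq c r f" and h: "poisson_seq c s h"
  shows "f i - h i \<le> (\<Sum>j\<in>{0..int N}. \<bar>r j - s j\<bar>) * (\<Sum>j\<in>{0..int N}. 1 / r j)"
proof -
  let ?d = "\<lambda>i. f i - h i"
  let ?B = "\<Sum>j\<in>{0..int N}. \<bar>r j - s j\<bar>"
  have "?d \<in> periodic N" by (simp add: per_arith per)
  then obtain k where k: "k \<in> {0..int N}" "\<And>i. ?d i \<le> ?d k" using per_obtains_max by blast
  obtain m where m: "m \<in> {0..int N}" "\<And>i. r m \<le> exp (- f i)"
    using poisson_seq_bounds[OF c per(1) f] by metis
  have B0: "?B \<ge> 0" by (simp add: sum_nonneg)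
  have "?d k \<le> ?B * (1 / r m)"
  proof (cases "?d k \<le> 0")
    case True
    then show ?thesis using B0 pos[of m] by (meson divide_nonneg_pos mult_nonneg_nonneg order_trans zero_le_one)
  next
    case False
    have "?d (k + 1) - 2 * ?d k + ?d (k - 1) \<le> 0" using k(2)[of "k + 1"] k(2)[of "k - 1"] by simp
    then have "c * (?d (k + 1) - 2 * ?d k + ?d (k - 1)) \<le> 0" using c by (simp add: mult_nonneg_nonpos)
    moreover have "c * (?d (k + 1) - 2 * ?d k + ?d (k - 1)) + exp (- f k) - exp (- h k) = r k - s k"
      using f[unfolded poisson_seq_def, rule_format, of k] h[unfolded poisson_seq_def, rule_format, of k]
      by (simp add: algebra_simps)
    moreover have "\<bar>r k - s k\<bar> \<le> ?B"
      using k(1) by (intro member_le_sum[where f = "\<lambda>j. \<bar>r j - s j\<bar>"]) auto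
    ultimately have le: "exp (- h k) - exp (- f k) \<le> ?B" by linarith
    have "r m * ?d k \<le> exp (- f k) * ?d k"
      using False m(2) by (intro mult_right_mono) auto
    also have "\<dots> \<le> exp (- f k) * (exp (?d k) - 1)"
      by (intro mult_left_mono) (use exp_ge_add_one_self[of "?d k"] in linarith, simp)
    also have "\<dots> = exp (- h k) - exp (- f k)"
      by (simp add: right_diff_distrib flip: exp_add)
    finally have "r m * ?d k \<le> ?B" using le by linarith
    then show ?thesis using pos[of m] by (simp add: field_simps)
  qed
  \<comment> \<open>The index m depends on f; the sum of all reciprocals removes it and leaves an
    expression that is visibly continuous in r.\<close>
  also have "\<dots> \<le> ?B * (\<Sum>j\<in>{0..int N}. 1 / r j)"
    using m(1) B0 pos by (intro mult_left_mono member_le_sum[where f = "\<lambda>j. 1 / r j"]) (auto simp: less_imp_le)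
  finally show ?thesis using k(2)[of i] by linarith
qed

lemma poisson_seq_solution_continuous:
  fixes r f :: "'z :: topological_space \<Rightarrow> int \<Rightarrow> real"
  assumes c: "c \<ge> 0" and per: "\<And>z. z \<in> Z \<Longrightarrow> f z \<in> periodic N"
    and pos: "\<And>z i. z \<in> Z \<Longrightarrow> r z i > 0"
    and cont: "\<And>i. continuous_on Z (\<lambda>z. r z i)"
    and eq: "\<And>z. z \<in> Z \<Longrightarrow> poisson_seq c (r z) (f z)"
  shows "continuous_on Z (\<lambda>z. f z i)"
proof (rule continuous_on_by_modulus[where B = "\<lambda>w z. (\<Sum>j\<in>{0..int N}. \<bar>r z j - r w j\<bar>) *
      ((\<Sum>j\<in>{0..int N}. 1 / r z j) + (\<Sum>j\<in>{0..int N}. 1 / r w j))"])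
  fix w assume w: "w \<in> Z"
  have "r z j \<noteq> 0" if "z \<in> Z" for z j using pos[OF that, of j] by simp
  then show "continuous_on Z (\<lambda>z. (\<Sum>j\<in>{0..int N}. \<bar>r z j - r w j\<bar>) *
      ((\<Sum>j\<in>{0..int N}. 1 / r z j) + (\<Sum>j\<in>{0..int N}. 1 / r w j)))"
    by (intro continuous_intros cont) auto
  show "(\<Sum>j\<in>{0..int N}. \<bar>r w j - r w j\<bar>) *
      ((\<Sum>j\<in>{0..int N}. 1 / r w j) + (\<Sum>j\<in>{0..int N}. 1 / r w j)) = 0" by simp
  fix z assume z: "z \<in> Z"
  let ?B = "\<Sum>j\<in>{0..int N}. \<bar>r z j - r w j\<bar>"
  have B: "(\<Sum>j\<in>{0..int N}. \<bar>r w j - r z j\<bar>) = ?B" by (simp add: abs_minus_commute)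
  have "f z i - f w i \<le> ?B * (\<Sum>j\<in>{0..int N}. 1 / r z j)"
    using poisson_seq_stability[OF c per[OF z] per[OF w] pos[OF z] eq[OF z] eq[OF w]] .
  moreover have "f w i - f z i \<le> ?B * (\<Sum>j\<in>{0..int N}. 1 / r w j)"
    using poisson_seq_stability[OF c per[OF w] per[OF z] pos[OF w] eq[OF w] eq[OF z]] unfolding B .
  moreover have "?B * (\<Sum>j\<in>{0..int N}. 1 / r w j) \<ge> 0" "?B * (\<Sum>j\<in>{0..int N}. 1 / r z j) \<ge> 0"
    using pos[OF w] pos[OF z] by (simp_all add: sum_nonneg less_imp_le)
  ultimately show "\<bar>f z i - f w i\<bar>
      \<le> ?B * ((\<Sum>j\<in>{0..int N}. 1 / r z j) + (\<Sum>j\<in>{0..int N}. 1 / r w j))"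
    unfolding distrib_left by linarith
qed

lemma disc_poisson_iff_seq:
  assumes "\<rho> \<in> X_primal N" "\<phi> \<in> X_primal N"
  shows "disc_poisson \<epsilon> N \<rho> \<phi> \<longleftrightarrow> poisson_seq ((\<epsilon> / dx N)\<^sup>2) (pval N \<rho>) (pval N \<phi>)"
proof -
  have eq: "\<epsilon>\<^sup>2 * disc_laplace N \<phi> i
      = (\<epsilon> / dx N)\<^sup>2 * (pval N \<phi> (i + 1) - 2 * pval N \<phi> i + pval N \<phi> (i - 1))" for i
    by (simp add: disc_laplace_def power_divide)
  have "(\<lambda>i. (\<epsilon> / dx N)\<^sup>2 * (pval N \<phi> (i + 1) - 2 * pval N \<phi> i + pval N \<phi> (i - 1))
           + exp (- pval N \<phi> i) = pval N \<rho> i) \<in> periodic N"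
    using pval_per[OF assms(1)] pval_per[OF assms(2)] by (simp add: per_arith)
  from per_ball_iff[OF this] show ?thesis
    by (simp add: disc_poisson_def poisson_seq_def eq)
qed

section \<open>A priori estimates for the discrete Poisson equation\<close>

lemma exp_minus_strongly_monotone:
  fixes a b \<alpha> :: real
  assumes "\<alpha> \<le> exp (- a)" "\<alpha> \<le> exp (- b)"
  shows "\<alpha> * (a - b)\<^sup>2 \<le> (exp (- b) - exp (- a)) * (a - b)"
proof -
  have *: "\<alpha> * (x - y) \<le> exp (- y) - exp (- x)" if "\<alpha> \<le> exp (- x)" "y \<le> x" for x y
  proof -
    have "\<alpha> * (x - y) \<le> exp (- x) * (x - y)" using that by (intro mult_right_mono) auto
    also have "\<dots> \<le> exp (- x) * (exp (x - y) - 1)"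
      by (intro mult_left_mono) (use exp_ge_add_one_self[of "x - y"] in linarith, simp)
    also have "\<dots> = exp (- y) - exp (- x)" by (simp add: right_diff_distrib flip: exp_add)
    finally show ?thesis .
  qed
  show ?thesis
  proof (cases "b \<le> a")
    case True
    then show ?thesis using mult_right_mono[OF *[OF assms(1) True], of "a - b"]
      by (simp add: power2_eq_square algebra_simps)
  next
    case False
    then show ?thesis using mult_right_mono[OF *[OF assms(2), of a], of "b - a"]
      by (simp add: power2_eq_square algebra_simps)
  qed
qed

text \<open>Weighted arithmetic-geometric form with weights 1/p and 1 - 1/p; it includes p = 1,
  where the conjugate exponent would be infinite.\<close>

lemma Young_powr_minus_one:
  fixes r y p :: real
  assumes "r > 0" "y > 0" "p \<ge> 1"
  shows "r * y powr (p - 1) \<le> r powr p / p + (1 - 1 / p) * y powr p"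
proof -
  have "(r powr p) powr (1 / p) * (y powr p) powr (1 - 1 / p) \<le> 1 / p * r powr p + (1 - 1 / p) * y powr p"
    using assms by (intro Youngs_inequality_0) (auto simp: field_simps)
  moreover have "p * (1 - 1 / p) = p - 1" using assms by (simp add: field_simps)
  ultimately show ?thesis using assms by (simp add: powr_powr)
qed

text \<open>The equation is tested with exp (- q f). As this is a nonincreasing function of f, every
  product of increments is nonpositive, and the absolute values merely record the sign from
  summation by parts. The case q = 0 is mass conservation.\<close>

lemma poisson_seq_power_identity:
  assumes "f \<in> periodic N" "poisson_seq c r f" "q \<ge> 0" "c \<ge> 0"
  shows "c * (\<Sum>i\<in>{0..int N}. \<bar>(f (i + 1) - f i) * (exp (- q * f (i + 1)) - exp (- q * f i))\<bar>)
           + (\<Sum>i\<in>{0..int N}. exp (- (q + 1) * f i))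
         = (\<Sum>i\<in>{0..int N}. r i * exp (- q * f i))"
proof -
  let ?E = "\<lambda>i. exp (- q * f i)"
  have "(f (i + 1) - f i) * (?E (i + 1) - ?E i) \<le> 0" for i
  proof (cases "f (i + 1) \<ge> f i")
    case True
    then show ?thesis using \<open>q \<ge> 0\<close> by (intro mult_nonneg_nonpos) (auto intro: mult_left_mono)
  next
    case False
    then show ?thesis using \<open>q \<ge> 0\<close> by (intro mult_nonpos_nonneg) (auto intro: mult_left_mono)
  qed
  then have "(\<Sum>i\<in>{0..int N}. \<bar>(f (i + 1) - f i) * (?E (i + 1) - ?E i)\<bar>)
      = - (\<Sum>i\<in>{0..int N}. (f (i + 1) - f i) * (?E (i + 1) - ?E i))"
    by (simp add: abs_of_nonpos sum_negf)
  also have "\<dots> = (\<Sum>i\<in>{0..int N}. (f (i + 1) - 2 * f i + f (i - 1)) * ?E i)"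
    using assms by (subst per_second_difference_by_parts) (auto simp: per_arith)
  finally have "c * (\<Sum>i\<in>{0..int N}. \<bar>(f (i + 1) - f i) * (?E (i + 1) - ?E i)\<bar>)
           + (\<Sum>i\<in>{0..int N}. exp (- (q + 1) * f i))
      = (\<Sum>i\<in>{0..int N}. c * (f (i + 1) - 2 * f i + f (i - 1)) * ?E i + exp (- (q + 1) * f i))"
    by (simp add: sum.distrib sum_distrib_left mult.assoc)
  also have "\<dots> = (\<Sum>i\<in>{0..int N}. r i * ?E i)"
  proof (intro sum.cong refl)
    fix i
    have "exp (- (q + 1) * f i) = exp (- f i) * ?E i" by (simp add: algebra_simps flip: exp_add)
    then have "c * (f (i + 1) - 2 * f i + f (i - 1)) * ?E i + exp (- (q + 1) * f i)
        = (c * (f (i + 1) - 2 * f i + f (i - 1)) + exp (- f i)) * ?E i" by (simp add: algebra_simps)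
    also have "\<dots> = r i * ?E i" using assms(2) by (simp add: poisson_seq_def)
    finally show "c * (f (i + 1) - 2 * f i + f (i - 1)) * ?E i + exp (- (q + 1) * f i) = r i * ?E i" .
  qed
  finally show ?thesis .
qed

lemma poisson_seq_mass:
  assumes "f \<in> periodic N" "poisson_seq c r f" "c \<ge> 0"
  shows "(\<Sum>i\<in>{0..int N}. exp (- f i)) = (\<Sum>i\<in>{0..int N}. r i)"
  using poisson_seq_power_identity[OF assms(1,2), of 0] assms(3) by simp

text \<open>Both estimates come from one inequality: after Young, the share (1 - 1/p) of
  \<open>?Y\<close> is absorbed on the left, leaving c \<open>?S\<close> + \<open>?Y\<close> / p
  \<le> \<open>?R\<close> / p.\<close>

lemma poisson_seq_power_estimate:
  assumes f: "f \<in> periodic N" "poisson_seq c r f" and p: "p \<ge> 1" and c: "c \<ge> 0" and pos: "\<And>i. r i > 0"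
  shows "(\<Sum>i\<in>{0..int N}. exp (- f i) powr p) \<le> (\<Sum>i\<in>{0..int N}. r i powr p)" (is "?Y \<le> ?R")
    and "c * (\<Sum>i\<in>{0..int N}. \<bar>(f (i + 1) - f i)
              * (exp (- (p - 1) * f (i + 1)) - exp (- (p - 1) * f i))\<bar>)
         \<le> (\<Sum>i\<in>{0..int N}. r i powr p)" (is "c * ?S \<le> _")
proof -
  have "c * ?S + ?Y = (\<Sum>i\<in>{0..int N}. r i * exp (- (p - 1) * f i))"
    using poisson_seq_power_identity[OF f, of "p - 1"] p c by (simp add: exp_powr_real mult.commute)
  also have "\<dots> \<le> (\<Sum>i\<in>{0..int N}. r i powr p / p + (1 - 1 / p) * exp (- f i) powr p)"
  proof (rule sum_mono)
    fix i
    have "exp (- (p - 1) * f i) = exp (- f i) powr (p - 1)" by (simp add: exp_powr_real algebra_simps)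
    then show "r i * exp (- (p - 1) * f i) \<le> r i powr p / p + (1 - 1 / p) * exp (- f i) powr p"
      using Young_powr_minus_one[of "r i" "exp (- f i)" p] pos p by simp
  qed
  also have "\<dots> = ?R / p + (1 - 1 / p) * ?Y"
    by (simp add: sum.distrib sum_distrib_left sum_divide_distrib)
  finally have le: "c * ?S + ?Y / p \<le> ?R / p" by (simp add: algebra_simps)
  have S0: "c * ?S \<ge> 0" using c by (simp add: sum_nonneg)
  have Y0: "?Y / p \<ge> 0" using p by (simp add: sum_nonneg)
  show "?Y \<le> ?R" using le S0 p by (smt (verit) divide_le_cancel)
  have "c * ?S \<le> ?R / p" using le Y0 by linarith
  also have "\<dots> \<le> ?R" using mult_left_mono[OF p, of ?R] p by (simp add: divide_le_eq sum_nonneg)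
  finally show "c * ?S \<le> ?R" .
qed

text \<open>Since f - m has zero sum, exp (- f) may be replaced by exp (- f) - exp (- m) in the
  tested equation. Strong monotonicity of exp (- f) in f, with modulus \<alpha>, then supplies the
  quadratic term.\<close>

lemma poisson_seq_energy_estimate:
  fixes m :: real
  assumes f: "f \<in> periodic N" "poisson_seq c r f" and \<alpha>: "\<And>i. \<alpha> \<le> exp (- f i)" "\<alpha> \<le> exp (- m)"
    and m: "(\<Sum>i\<in>{0..int N}. f i - m) = 0"
  shows "c * (\<Sum>i\<in>{0..int N}. (f (i + 1) - f i)\<^sup>2) + \<alpha> * (\<Sum>i\<in>{0..int N}. (f i - m)\<^sup>2)
         \<le> - (\<Sum>i\<in>{0..int N}. r i * (f i - m))"
proof -
  have "(\<Sum>i\<in>{0..int N}. r i * (f i - m))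
      = (\<Sum>i\<in>{0..int N}. c * ((f (i + 1) - 2 * f i + f (i - 1)) * (f i - m)) + exp (- f i) * (f i - m))"
    using f(2) unfolding poisson_seq_def
    by (intro sum.cong refl) (metis (no_types, lifting) distrib_right mult.assoc)
  also have "\<dots> = - (c * (\<Sum>i\<in>{0..int N}. (f (i + 1) - f i)\<^sup>2)) + (\<Sum>i\<in>{0..int N}. exp (- f i) * (f i - m))"
    using per_second_difference_by_parts[of f N "\<lambda>i. f i - m"] f(1)
    by (simp add: sum.distrib per_arith power2_eq_square flip: sum_distrib_left)
  also have "(\<Sum>i\<in>{0..int N}. exp (- f i) * (f i - m))
      \<le> (\<Sum>i\<in>{0..int N}. exp (- m) * (f i - m) - \<alpha> * (f i - m)\<^sup>2)"
  proof (rule sum_mono)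
    fix i
    show "exp (- f i) * (f i - m) \<le> exp (- m) * (f i - m) - \<alpha> * (f i - m)\<^sup>2"
      using exp_minus_strongly_monotone[OF \<alpha>(1)[of i] \<alpha>(2)]
      unfolding left_diff_distrib[of "exp (- m)"] by linarith
  qed
  also have "\<dots> = - (\<alpha> * (\<Sum>i\<in>{0..int N}. (f i - m)\<^sup>2))"
    using m by (simp add: sum_subtractf flip: sum_distrib_left)
  finally show ?thesis by linarith
qed

lemma Lp_norm_nonneg: "Lp_norm p f \<ge> 0"
  by (simp add: Lp_norm_def)

lemma Lp_norm_2_X_primal:
  assumes "v \<in> X_primal N"
  shows "Lp_norm 2 v = sqrt (\<Sum>i\<in>{0..int N}. (pval N v i)\<^sup>2 * dx N)"
proof -
  have "\<bar>x\<bar> powr 2 = x\<^sup>2" for x :: real by (simp add: powr_numeral)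
  then show ?thesis
    using dx_pos[of N] by (simp add: Lp_norm_X_primal[OF assms] powr_half_sqrt sum_nonneg)
qed

lemma Lp_norm_1_X_primal:
  assumes "v \<in> X_primal N"
  shows "Lp_norm 1 v = (\<Sum>i\<in>{0..int N}. \<bar>pval N v i\<bar> * dx N)"
  using dx_pos[of N] by (simp add: Lp_norm_X_primal[OF assms] sum_nonneg)

lemma elliptic_estimates_hold:
  assumes \<rho>: "\<rho> \<in> X_primal N" and \<phi>: "\<phi> \<in> X_primal N" and pos: "\<And>i. pval N \<rho> i > 0"
    and poisson: "disc_poisson \<epsilon> N \<rho> \<phi>" and \<epsilon>: "\<epsilon> > 0"
  shows "elliptic_estimates \<epsilon> N \<rho> \<phi>"
proof -
  define r f where "r = pval N \<rho>" and "f = pval N \<phi>"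
  define c where "c = (\<epsilon> / dx N)\<^sup>2"
  define \<alpha> where "\<alpha> = exp (min_log N \<rho>)"
  define m where "m = disc_mean N \<phi>"
  have r: "r \<in> periodic N" and f: "f \<in> periodic N" using \<rho> \<phi> by (simp_all add: r_def f_def pval_per)
  have r0: "r i > 0" for i using pos by (simp add: r_def)
  have d0: "dx N > 0" by (rule dx_pos)
  have c0: "c \<ge> 0" by (simp add: c_def)
  have P: "poisson_seq c r f" using poisson disc_poisson_iff_seq[OF \<rho> \<phi>] by (simp add: c_def r_def f_def)
  have X: "(\<lambda>x. exp (- \<phi> x)) \<in> X_primal N" by (rule X_primal_map[OF \<phi>])
  have W: "(\<lambda>x. \<phi> x - m) \<in> X_primal N" by (rule X_primal_map[OF \<phi>])
  have Rp: "Lp_norm p \<rho> = (\<Sum>i\<in>{0..int N}. r i powr p * dx N) powr (1 / p)" for p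
    using r0 by (simp add: Lp_norm_X_primal[OF \<rho>] r_def less_imp_le)
  have Ep: "Lp_norm p (\<lambda>x. exp (- \<phi> x)) = (\<Sum>i\<in>{0..int N}. exp (- f i) powr p * dx N) powr (1 / p)" for p
    by (simp add: Lp_norm_X_primal[OF X] f_def pval_def)
  have e1: "Lp_norm p (\<lambda>x. exp (- \<phi> x)) \<le> Lp_norm p \<rho>" if "p \<ge> 1" for p
    unfolding Rp Ep sum_distrib_right[symmetric]
    using poisson_seq_power_estimate(1)[OF f P that c0 r0] d0 that
    by (intro powr_mono2 mult_right_mono) (auto intro!: mult_nonneg_nonneg sum_nonneg)
  have e2: "Lp_norm 1 (\<lambda>x. exp (- \<phi> x)) = Lp_norm 1 \<rho>"
    using poisson_seq_mass[OF f P c0] r0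
    by (simp add: Rp Ep less_imp_le flip: sum_distrib_right)
  have e3: "\<epsilon>\<^sup>2 * (\<Sum>i\<in>{0..int N}. \<bar>(f (i + 1) - f i) / dx N
               * ((exp (- (p - 1) * f (i + 1)) - exp (- (p - 1) * f i)) / dx N)\<bar> * dx N)
          \<le> Lp_norm p \<rho> powr p" (is "?L \<le> _") if p: "p \<ge> 1" for p
  proof -
    have "?L = c * (\<Sum>i\<in>{0..int N}. \<bar>(f (i + 1) - f i)
              * (exp (- (p - 1) * f (i + 1)) - exp (- (p - 1) * f i))\<bar>) * dx N"
      using d0 unfolding c_def sum_distrib_left sum_distrib_right
      by (intro sum.cong refl) (simp add: abs_mult power2_eq_square)
    also have "\<dots> \<le> (\<Sum>i\<in>{0..int N}. r i powr p) * dx N"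
      using d0 by (intro mult_right_mono poisson_seq_power_estimate(2)[OF f P p c0 r0]) auto
    also have "\<dots> = Lp_norm p \<rho> powr p"
      using p d0 by (simp add: Rp powr_powr sum_nonneg sum_distrib_right)
    finally show ?thesis .
  qed
  obtain k l where kl: "k \<in> {0..int N}" "\<And>i. r k \<le> exp (- f i)" "l \<in> {0..int N}" "\<And>i. exp (- f i) \<le> r l"
    using poisson_seq_bounds[OF c0 f P] by metis
  have lo: "min_log N \<rho> \<le> - f i" for i
  proof -
    have "min_log N \<rho> \<le> ln (r k)" unfolding min_log_def r_def using kl(1) by (intro Min_le) auto
    also have "\<dots> \<le> - f i" using kl(2)[of i] r0[of k] by (metis exp_gt_zero ln_exp ln_le_cancel_iff)
    finally show ?thesis .
  qed
  have hi: "- f i \<le> max_log N \<rho>" for i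
  proof -
    have "- f i \<le> ln (r l)" using kl(4)[of i] r0[of l] by (simp add: ln_ge_iff)
    also have "\<dots> \<le> max_log N \<rho>" unfolding max_log_def r_def using kl(3) by (intro Max_ge) auto
    finally show ?thesis .
  qed
  have mean: "disc_mean N (\<lambda>x. - \<phi> x) = (\<Sum>i\<in>{0..int N}. - f i * dx N)"
    by (simp add: disc_mean_def f_def pval_def)
  then have mean': "disc_mean N (\<lambda>x. - \<phi> x) = - m"
    by (simp add: m_def disc_mean_def f_def sum_negf)
  have "(\<Sum>i\<in>{0..int N}. min_log N \<rho> * dx N) \<le> (\<Sum>i\<in>{0..int N}. - f i * dx N)"
    "(\<Sum>i\<in>{0..int N}. - f i * dx N) \<le> (\<Sum>i\<in>{0..int N}. max_log N \<rho> * dx N)"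
    using lo hi d0 by (intro sum_mono mult_right_mono; simp)+
  then have mlo: "min_log N \<rho> \<le> - m" and mhi: "- m \<le> max_log N \<rho>"
    unfolding sum_dx mean'[symmetric] mean by simp_all
  have \<alpha>0: "\<alpha> > 0" by (simp add: \<alpha>_def)
  define V where "V = Lp_norm 2 (\<lambda>x. \<phi> x - m)"
  define H where "H = H1_seminorm N (\<lambda>x. \<phi> x - m)"
  define R where "R = Lp_norm 2 \<rho>"
  have V0: "V \<ge> 0" and R0: "R \<ge> 0" and H0: "H \<ge> 0"
    using d0 by (simp_all add: V_def R_def H_def Lp_norm_nonneg H1_seminorm_def sum_nonneg)
  have V2: "V\<^sup>2 = (\<Sum>i\<in>{0..int N}. (f i - m)\<^sup>2) * dx N"
    using d0 by (simp add: V_def Lp_norm_2_X_primal[OF W] sum_nonneg sum_distrib_right f_def pval_def)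
  have R2: "R\<^sup>2 = (\<Sum>i\<in>{0..int N}. (r i)\<^sup>2) * dx N"
    using d0 by (simp add: R_def Lp_norm_2_X_primal[OF \<rho>] sum_nonneg sum_distrib_right r_def)
  have H2: "\<epsilon>\<^sup>2 * H\<^sup>2 = c * (\<Sum>i\<in>{0..int N}. (f (i + 1) - f i)\<^sup>2) * dx N"
    using d0 by (simp add: H_def H1_seminorm_def sum_nonneg disc_delta_def c_def f_def pval_def
        power_divide sum_distrib_left sum_distrib_right mult.assoc)
  have "(\<Sum>i\<in>{0..int N}. (f i - m) * dx N) = 0"
    using sum_dx[of m N] by (simp add: left_diff_distrib sum_subtractf m_def disc_mean_def f_def)
  then have "(\<Sum>i\<in>{0..int N}. f i - m) = 0"
    using d0 by (simp flip: sum_distrib_right)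
  then have "c * (\<Sum>i\<in>{0..int N}. (f (i + 1) - f i)\<^sup>2) + \<alpha> * (\<Sum>i\<in>{0..int N}. (f i - m)\<^sup>2)
         \<le> - (\<Sum>i\<in>{0..int N}. r i * (f i - m))"
    using lo mlo by (intro poisson_seq_energy_estimate[OF f P]) (auto simp: \<alpha>_def)
  from mult_right_mono[OF this, of "dx N"]
  have "\<epsilon>\<^sup>2 * H\<^sup>2 + \<alpha> * V\<^sup>2 \<le> - (\<Sum>i\<in>{0..int N}. r i * (f i - m)) * dx N"
    using d0 unfolding H2 V2 by (simp add: distrib_right mult.assoc)
  \<comment> \<open>Cauchy-Schwarz; one factor \<open>dx N\<close> goes to each of the two discrete
    L2 norms.\<close>
  also have "\<dots> \<le> R * V"
  proof -
    have "(- (\<Sum>i\<in>{0..int N}. r i * (f i - m)) * dx N)\<^sup>2 = (\<Sum>i\<in>{0..int N}. r i * (f i - m))\<^sup>2 * (dx N)\<^sup>2"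
      by (simp add: power_mult_distrib)
    also have "\<dots> \<le> ((\<Sum>i\<in>{0..int N}. (r i)\<^sup>2) * (\<Sum>i\<in>{0..int N}. (f i - m)\<^sup>2)) * (dx N)\<^sup>2"
      by (intro mult_right_mono Cauchy_Schwarz_ineq_sum) auto
    also have "\<dots> = (R * V)\<^sup>2" unfolding power_mult_distrib R2 V2 by (simp add: power2_eq_square)
    finally show ?thesis by (rule power2_le_imp_le) (simp add: R0 V0)
  qed
  finally have key: "\<epsilon>\<^sup>2 * H\<^sup>2 + \<alpha> * V\<^sup>2 \<le> R * V" .
  have aV: "\<alpha> * V \<le> R"
  proof (cases "V = 0")
    case False
    have "(\<alpha> * V) * V \<le> R * V"
      using key zero_le_power2[of "\<epsilon> * H"] by (simp add: power2_eq_square algebra_simps)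
    then show ?thesis using V0 False by simp
  qed (use R0 in simp)
  \<comment> \<open>The term \<alpha> V^2 is dropped and V is replaced by its bound R / \<alpha>
    just obtained; the square root of that 1 / \<alpha> is the factor in the H1 estimate.\<close>
  have "(\<epsilon> * H)\<^sup>2 \<le> R * V"
    using key \<alpha>0 zero_le_power2[of V] by (smt (verit) mult_nonneg_nonneg power_mult_distrib)
  also have "\<dots> \<le> R * (R / \<alpha>)"
    using aV \<alpha>0 R0 by (intro mult_left_mono) (auto simp: field_simps)
  also have "\<dots> = (1 / sqrt \<alpha> * R)\<^sup>2"
    using \<alpha>0 by (simp add: power_mult_distrib power_divide power2_eq_square)
  finally have eH: "\<epsilon> * H \<le> 1 / sqrt \<alpha> * R"
    using R0 \<alpha>0 by (elim power2_le_imp_le) auto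
  have "1 / sqrt \<alpha> * Lp_norm 1 \<rho> \<ge> 0" using \<alpha>0 by (simp add: Lp_norm_nonneg)
  then have e7: "\<epsilon> * H \<le> 1 / sqrt \<alpha> * (R + Lp_norm 1 \<rho>)" using eH unfolding distrib_left by linarith
  have e6: "\<alpha> * V \<le> R + Lp_norm 1 \<rho>" using aV Lp_norm_nonneg[of 1 \<rho>] by linarith
  show ?thesis
    unfolding elliptic_estimates_def Let_def mean'
    unfolding \<alpha>_def[symmetric] m_def[symmetric] V_def[symmetric] H_def[symmetric] R_def[symmetric]
      f_def[symmetric]
    using e1 e2 e3 lo hi mlo mhi e6 e7 by blast
qed

section \<open>Energy balance\<close>

text \<open>As h'(s) = s exp (- s), the terms combine to exp (- a) - exp (- a) (b - a) - exp (- b),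
  which is minus the second-order Taylor remainder of exp (- s) at a. Its Lagrange form provides the
  intermediate numbers \<xi> of the dissipation.\<close>

lemma exp_minus_taylor2:
  fixes a b :: real
  obtains \<xi> where "strictly_between a b \<xi>"
    "(exp (- b) - exp (- a)) * b = - (hfun b - hfun a) - exp (- \<xi>) * ((b - a)\<^sup>2 / 2)"
proof (cases "a = b")
  case True
  then show ?thesis using that[of a] by (simp add: strictly_between_def)
next
  case False
  define diff where "diff m x = (- 1) ^ m * exp (- x)" for m :: nat and x :: real
  have d0: "diff 0 = (\<lambda>x. exp (- x))" by (simp add: diff_def fun_eq_iff)
  have deriv: "DERIV (diff m) x :> diff (Suc m) x" for m x
    unfolding diff_def by (auto intro!: derivative_eq_intros)
  have "\<exists>t. (if b < a then b < t \<and> t < a else a < t \<and> t < b) \<and>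
      exp (- b) = (\<Sum>m<2. diff m a / fact m * (b - a) ^ m) + diff 2 t / fact 2 * (b - a) ^ 2"
    using False d0 deriv
    by (intro Taylor[where a = "min a b" and b = "max a b" and f = "\<lambda>x. exp (- x)"]) auto
  then obtain t where t: "if b < a then b < t \<and> t < a else a < t \<and> t < b"
    and eq: "exp (- b) = (\<Sum>m<2. diff m a / fact m * (b - a) ^ m) + diff 2 t / fact 2 * (b - a) ^ 2"
    by blast
  have "exp (- b) = exp (- a) - exp (- a) * (b - a) + exp (- t) * ((b - a)\<^sup>2 / 2)"
    using eq by (simp add: diff_def numeral_2_eq_2)
  then have "(exp (- b) - exp (- a)) * b = - (hfun b - hfun a) - exp (- t) * ((b - a)\<^sup>2 / 2)"
    by (simp add: hfun_def algebra_simps)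
  then show ?thesis
    using that[of t] t False by (auto simp: strictly_between_def split: if_splits)
qed

text \<open>Makes the energy bound the kinetic part from above: the potential terms contribute at
  least -1 over the whole torus.\<close>

lemma hfun_ge: "hfun s \<ge> - 1"
proof -
  have "(s + 1) * exp (- s) \<le> exp s * exp (- s)"
    using exp_ge_add_one_self[of s] by (intro mult_right_mono) (linarith, simp)
  then show ?thesis by (simp add: hfun_def algebra_simps flip: exp_add)
qed

section \<open>Kinetic balance and work of the electric field\<close>

definition momentum_residual where
  "momentum_residual g N dt \<rho> u \<rho>' u' \<phi>' i =
     (rho_dual N \<rho>' i * dval N u' i - rho_dual N \<rho> i * dval N u i) / dt
       + (flux_primal g N \<rho>' u' (i + 1) * u_upwind g N \<rho>' u' (i + 1)
          - flux_primal g N \<rho>' u' i * u_upwind g N \<rho>' u' i) / dx N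
     - rho_tilde g N \<rho>' u' i * disc_delta N \<phi>' i"

definition mass_balance where
  "mass_balance g N dt \<rho> \<rho>' u' \<longleftrightarrow>
     (\<forall>i. (pval N \<rho>' i - pval N \<rho> i) / dt
          + (flux_dual g N \<rho>' u' i - flux_dual g N \<rho>' u' (i - 1)) / dx N = 0)"

lemma flux_dual_per:
  assumes "\<rho> \<in> X_primal N" "u \<in> X_dual N"
  shows "flux_dual g N \<rho> u \<in> periodic N"
  using pval_per[OF assms(1)] dval_per[OF assms(2)]
  unfolding flux_dual_def[abs_def] Gfun_def by (simp add: per_arith per_map)

lemma flux_primal_per:
  assumes "\<rho> \<in> X_primal N" "u \<in> X_dual N"
  shows "flux_primal g N \<rho> u \<in> periodic N"
  using flux_dual_per[OF assms, of g] unfolding flux_primal_def[abs_def] by (simp add: per_arith)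

lemma u_upwind_per:
  assumes "\<rho> \<in> X_primal N" "u \<in> X_dual N"
  shows "u_upwind g N \<rho> u \<in> periodic N"
proof -
  have "(\<lambda>i. dval N u (i - 1)) \<in> periodic N" using dval_per[OF assms(2)] by (rule per_shift)
  then show ?thesis
    using flux_primal_per[OF assms, of g] dval_per[OF assms(2)]
    unfolding u_upwind_def[abs_def] periodic_def mem_Collect_eq by presburger
qed

text \<open>The two sides differ by v^2 / 2 times the mass balance. Here a and b stand for 1/dt and
  1/dx, P and Q for the fluxes at the two ends of a dual cell, X and Y for the upwind velocities
  there, and v and w for the new and old velocity.\<close>

lemma kinetic_identity:
  fixes a b :: real
  assumes "(r' - r) * a + (P - Q) * b = 0"
  shows "((r' * v - r * w) * a + (P * X - Q * Y) * b) * v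
     = (r' * (v\<^sup>2 / 2) - r * (w\<^sup>2 / 2)) * a
       + (- P * ((X - v)\<^sup>2 * b / 2) + Q * ((Y - v)\<^sup>2 * b / 2) + r * ((w - v)\<^sup>2 * a / 2))
       + (P * (X\<^sup>2 / 2) - Q * (Y\<^sup>2 / 2)) * b"
proof -
  have "((r' * v - r * w) * a + (P * X - Q * Y) * b) * v
     - ((r' * (v\<^sup>2 / 2) - r * (w\<^sup>2 / 2)) * a
       + (- P * ((X - v)\<^sup>2 * b / 2) + Q * ((Y - v)\<^sup>2 * b / 2) + r * ((w - v)\<^sup>2 * a / 2))
       + (P * (X\<^sup>2 / 2) - Q * (Y\<^sup>2 / 2)) * b)
     = v\<^sup>2 / 2 * ((r' - r) * a + (P - Q) * b)"
    by (simp add: power2_eq_square field_simps)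
  with assms show ?thesis by simp
qed

lemma kinetic_balance:
  assumes X: "\<rho>' \<in> X_primal N" "u' \<in> X_dual N" and mass: "mass_balance g N dt \<rho> \<rho>' u'"
  shows "(\<Sum>i\<in>{0..int N}. momentum_residual g N dt \<rho> u \<rho>' u' \<phi>' i * dval N u' i)
    = (\<Sum>i\<in>{0..int N}. (rho_dual N \<rho>' i * ((dval N u' i)\<^sup>2 / 2) - rho_dual N \<rho> i * ((dval N u i)\<^sup>2 / 2)) / dt
         + S_term g N dt \<rho> u \<rho>' u' i
         - rho_tilde g N \<rho>' u' i * dval N u' i * disc_delta N \<phi>' i)"
proof -
  let ?P = "flux_primal g N \<rho>' u'" and ?U = "u_upwind g N \<rho>' u'"
  let ?E = "\<lambda>i. ?P i * ((?U i)\<^sup>2 / 2)"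
  \<comment> \<open>Half the sum of the mass balances of two neighbouring primal cells is the mass
    balance of the dual cell between them; this is why both \<open>rho_dual\<close> and
    \<open>flux_primal\<close> are averages.\<close>
  have dual: "(rho_dual N \<rho>' i - rho_dual N \<rho> i) * (1 / dt) + (?P (i + 1) - ?P i) * (1 / dx N) = 0" for i
  proof -
    have "(rho_dual N \<rho>' i - rho_dual N \<rho> i) * (1 / dt) + (?P (i + 1) - ?P i) * (1 / dx N)
      = 1 / 2 * ((pval N \<rho>' i - pval N \<rho> i) / dt
          + (flux_dual g N \<rho>' u' i - flux_dual g N \<rho>' u' (i - 1)) / dx N)
        + 1 / 2 * ((pval N \<rho>' (i + 1) - pval N \<rho> (i + 1)) / dt
          + (flux_dual g N \<rho>' u' (i + 1) - flux_dual g N \<rho>' u' (i + 1 - 1)) / dx N)"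
      unfolding rho_dual_def flux_primal_def divide_inverse
      by (simp add: algebra_simps)
    also have "\<dots> = 0" using mass unfolding mass_balance_def by (metis add_0 mult_zero_right)
    finally show ?thesis .
  qed
  have "momentum_residual g N dt \<rho> u \<rho>' u' \<phi>' i * dval N u' i
    = ((rho_dual N \<rho>' i * ((dval N u' i)\<^sup>2 / 2) - rho_dual N \<rho> i * ((dval N u i)\<^sup>2 / 2)) / dt
         + S_term g N dt \<rho> u \<rho>' u' i
         - rho_tilde g N \<rho>' u' i * dval N u' i * disc_delta N \<phi>' i)
       + (?E (i + 1) - ?E i) * (1 / dx N)" for i
    using kinetic_identity[OF dual[of i], of "dval N u' i" "dval N u i" "?U (i + 1)" "?U i"]
    unfolding momentum_residual_def S_term_def
    by (simp add: algebra_simps add_divide_distrib diff_divide_distrib)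
  moreover have "?E \<in> periodic N"
    using flux_primal_per[OF X, of g] u_upwind_per[OF X, of g] by (simp add: per_arith)
  then have "(\<Sum>i\<in>{0..int N}. (?E (i + 1) - ?E i) * (1 / dx N)) = 0"
    unfolding sum_distrib_right[symmetric] using per_sum_telescope(1)[of ?E N] by simp
  ultimately show ?thesis by (simp only: sum.distrib add_0_right)
qed

text \<open>\<open>rho_tilde\<close> is a difference quotient in u, and G(s,t,0) = g(0) (s - t). The
  leftover term is the only source of the g(0) contributions to the dissipation.\<close>

lemma rho_tilde_mult_dval:
  "rho_tilde g N \<rho> u i * dval N u i
     = flux_dual g N \<rho> u i + g 0 * (pval N \<rho> (i + 1) - pval N \<rho> i)"
proof (cases "dval N u i = 0")
  case False
  then have "rho_tilde g N \<rho> u i * dval N u i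
      = Gfun g (pval N \<rho> i) (pval N \<rho> (i + 1)) (dval N u i) - Gfun g (pval N \<rho> i) (pval N \<rho> (i + 1)) 0"
    by (simp add: rho_tilde_def)
  then show ?thesis by (simp add: flux_dual_def Gfun_def algebra_simps)
qed (simp add: flux_dual_def Gfun_def algebra_simps)

text \<open>Summation by parts moves the second difference onto f, and the equation then replaces r.
  The first part becomes a square; the second is a product of increments of f and exp (- f), which
  always have opposite signs.\<close>

lemma poisson_seq_gradient_product:
  assumes f: "f \<in> periodic N" "r \<in> periodic N" "poisson_seq c r f"
  shows "(\<Sum>i\<in>{0..int N}. (r (i + 1) - r i) * (f (i + 1) - f i))
     = - (c * (\<Sum>i\<in>{0..int N}. (f (i + 1) - 2 * f i + f (i - 1))\<^sup>2))
       - (\<Sum>i\<in>{0..int N}. \<bar>(exp (- f i) - exp (- f (i - 1))) * (f i - f (i - 1))\<bar>)"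
proof -
  let ?D = "\<lambda>i. f (i + 1) - 2 * f i + f (i - 1)"
  let ?e = "\<lambda>i. exp (- f i)"
  have e: "?e \<in> periodic N" using f by (simp add: per_arith)
  have "(\<Sum>i\<in>{0..int N}. (r (i + 1) - r i) * (f (i + 1) - f i)) = - (\<Sum>i\<in>{0..int N}. ?D i * r i)"
    using per_second_difference_by_parts[OF f(1,2)] by (simp add: mult.commute)
  also have "(\<Sum>i\<in>{0..int N}. ?D i * r i) = (\<Sum>i\<in>{0..int N}. c * (?D i)\<^sup>2 + ?D i * ?e i)"
  proof (intro sum.cong refl)
    fix i
    have r: "r i = c * ?D i + ?e i" using f(3) by (simp add: poisson_seq_def)
    show "?D i * r i = c * (?D i)\<^sup>2 + ?D i * ?e i"
      unfolding r by (simp add: power2_eq_square algebra_simps)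
  qed
  also have "\<dots> = c * (\<Sum>i\<in>{0..int N}. (?D i)\<^sup>2) + (\<Sum>i\<in>{0..int N}. ?D i * ?e i)"
    by (simp add: sum.distrib sum_distrib_left)
  also have "(\<Sum>i\<in>{0..int N}. ?D i * ?e i) = - (\<Sum>i\<in>{0..int N}. (f (i + 1) - f i) * (?e (i + 1) - ?e i))"
    by (rule per_second_difference_by_parts[OF f(1) e])
  also have "(\<Sum>i\<in>{0..int N}. (f (i + 1) - f i) * (?e (i + 1) - ?e i))
      = (\<Sum>i\<in>{0..int N}. (f i - f (i - 1)) * (?e i - ?e (i - 1)))"
    using per_sum_shift(1)[of "\<lambda>i. (f i - f (i - 1)) * (?e i - ?e (i - 1))" N] f e by (simp add: per_arith)
  also have "\<dots> = - (\<Sum>i\<in>{0..int N}. \<bar>(?e i - ?e (i - 1)) * (f i - f (i - 1))\<bar>)"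
  proof -
    have "(?e i - ?e (i - 1)) * (f i - f (i - 1)) \<le> 0" for i
      by (cases "f i \<ge> f (i - 1)") (auto simp: mult_nonpos_nonneg mult_nonneg_nonpos)
    then show ?thesis by (simp add: abs_of_nonpos sum_negf mult.commute)
  qed
  finally show ?thesis by simp
qed

text \<open>The difference of the Poisson equations at the two times is tested with the new
  potential. The gradient part uses 2 (a - b) a = a^2 - b^2 + (a - b)^2, the last square being the
  dissipation of implicit Euler; the exponential part is \<open>exp_minus_taylor2\<close>.\<close>

lemma potential_balance:
  assumes f: "f \<in> periodic N" "poisson_seq c r f" and f': "f' \<in> periodic N" "poisson_seq c r' f'"
    and \<xi>: "\<And>i. i \<in> {0..int N} \<Longrightarrow>
      (exp (- f' i) - exp (- f i)) * f' i = - (hfun (f' i) - hfun (f i)) - exp (- \<xi> i) * ((f' i - f i)\<^sup>2 / 2)"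
  shows "(\<Sum>i\<in>{0..int N}. (r' i - r i) * f' i)
     = - (c / 2 * (\<Sum>i\<in>{0..int N}. (f' (i + 1) - f' i)\<^sup>2 - (f (i + 1) - f i)\<^sup>2
              + ((f' (i + 1) - f' i) - (f (i + 1) - f i))\<^sup>2))
       - (\<Sum>i\<in>{0..int N}. hfun (f' i) - hfun (f i) + exp (- \<xi> i) * ((f' i - f i)\<^sup>2 / 2))"
proof -
  let ?w = "\<lambda>i. f' i - f i"
  have w: "?w \<in> periodic N" using f f' by (simp add: per_arith)
  have "(r' i - r i) * f' i = c * ((?w (i + 1) - 2 * ?w i + ?w (i - 1)) * f' i)
      + (exp (- f' i) - exp (- f i)) * f' i" for i
  proof -
    have r: "r' i = c * (f' (i + 1) - 2 * f' i + f' (i - 1)) + exp (- f' i)"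
      "r i = c * (f (i + 1) - 2 * f i + f (i - 1)) + exp (- f i)"
      using f f' by (simp_all add: poisson_seq_def)
    show ?thesis unfolding r by (simp add: algebra_simps)
  qed
  then have "(\<Sum>i\<in>{0..int N}. (r' i - r i) * f' i)
     = c * (\<Sum>i\<in>{0..int N}. (?w (i + 1) - 2 * ?w i + ?w (i - 1)) * f' i)
       + (\<Sum>i\<in>{0..int N}. (exp (- f' i) - exp (- f i)) * f' i)"
    by (simp add: sum.distrib sum_distrib_left)
  also have "(\<Sum>i\<in>{0..int N}. (?w (i + 1) - 2 * ?w i + ?w (i - 1)) * f' i)
     = - (\<Sum>i\<in>{0..int N}. (?w (i + 1) - ?w i) * (f' (i + 1) - f' i))"
    by (rule per_second_difference_by_parts[OF w f'(1)])
  also have "(\<Sum>i\<in>{0..int N}. (?w (i + 1) - ?w i) * (f' (i + 1) - f' i))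
     = 1 / 2 * (\<Sum>i\<in>{0..int N}. (f' (i + 1) - f' i)\<^sup>2 - (f (i + 1) - f i)\<^sup>2
              + ((f' (i + 1) - f' i) - (f (i + 1) - f i))\<^sup>2)"
    unfolding sum_distrib_left
    by (intro sum.cong refl) (simp add: power2_eq_square field_simps)
  also have "(\<Sum>i\<in>{0..int N}. (exp (- f' i) - exp (- f i)) * f' i)
     = - (\<Sum>i\<in>{0..int N}. hfun (f' i) - hfun (f i) + exp (- \<xi> i) * ((f' i - f i)\<^sup>2 / 2))"
    using \<xi> by (simp add: sum_negf[symmetric])
  finally show ?thesis by simp
qed

text \<open>Summation by parts turns flux times potential gradient into flux divergence times
  potential, and the mass balance trades the divergence for the time increment of \<rho>. The second
  term is the zero-velocity flux.\<close>

lemma field_work: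
  assumes X: "\<rho>' \<in> X_primal N" "u' \<in> X_dual N" "\<phi>' \<in> X_primal N"
    and mass: "mass_balance g N dt \<rho> \<rho>' u'" and dt: "dt > 0"
  shows "dt * (\<Sum>i\<in>{0..int N}. rho_tilde g N \<rho>' u' i * dval N u' i * disc_delta N \<phi>' i * dx N)
     = (\<Sum>i\<in>{0..int N}. (pval N \<rho>' i - pval N \<rho> i) * pval N \<phi>' i) * dx N
       + dt * g 0 * (\<Sum>i\<in>{0..int N}. (pval N \<rho>' (i + 1) - pval N \<rho>' i) * (pval N \<phi>' (i + 1) - pval N \<phi>' i))"
proof -
  let ?F = "flux_dual g N \<rho>' u'" and ?f = "pval N \<phi>'" and ?r = "pval N \<rho>'"
  have d0: "dx N > 0" by (rule dx_pos)
  have dd: "disc_delta N \<phi>' i * dx N = ?f (i + 1) - ?f i" for i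
    using d0 by (simp add: disc_delta_def)
  have "(\<Sum>i\<in>{0..int N}. rho_tilde g N \<rho>' u' i * dval N u' i * disc_delta N \<phi>' i * dx N)
     = (\<Sum>i\<in>{0..int N}. ?F i * (?f (i + 1) - ?f i))
       + g 0 * (\<Sum>i\<in>{0..int N}. (?r (i + 1) - ?r i) * (?f (i + 1) - ?f i))"
    unfolding rho_tilde_mult_dval sum_distrib_left sum.distrib[symmetric]
    by (intro sum.cong refl) (simp add: mult.assoc dd distrib_right)
  also have "(\<Sum>i\<in>{0..int N}. ?F i * (?f (i + 1) - ?f i)) = - (\<Sum>i\<in>{0..int N}. (?F i - ?F (i - 1)) * ?f i)"
    using per_sum_by_parts[OF flux_dual_per[OF X(1,2), of g] pval_per[OF X(3)]] by simp
  also have "\<dots> = (\<Sum>i\<in>{0..int N}. (?r i - pval N \<rho> i) * ?f i) * dx N / dt"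
  proof -
    have "- (?F i - ?F (i - 1)) = (?r i - pval N \<rho> i) * (dx N / dt)" for i
    proof -
      have "(?r i - pval N \<rho> i) / dt + (?F i - ?F (i - 1)) / dx N = 0"
        using mass unfolding mass_balance_def by blast
      then show ?thesis using d0 dt by (simp add: field_simps)
    qed
    then have "- ((?F i - ?F (i - 1)) * ?f i) = (?r i - pval N \<rho> i) * ?f i * (dx N / dt)" for i
      by (metis (no_types, opaque_lifting) minus_mult_left mult.assoc mult.commute)
    then show ?thesis by (simp add: sum_negf[symmetric] sum_distrib_right sum_divide_distrib)
  qed
  finally show ?thesis using dt by (simp add: algebra_simps)
qed

text \<open>The kinetic balance leaves the work \<open>Wk\<close> of the field. It is exchanged for
  \<open>RF\<close>, the density increment tested with the new potential, plus g(0) diffusion;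
  \<open>RF\<close> in turn is minus the growth of the potential energy minus its dissipation. With
  each sum named as a scalar, the conclusion is plain algebra.\<close>

lemma energy_balance:
  assumes X: "\<rho> \<in> X_primal N" "\<phi> \<in> X_primal N" "\<rho>' \<in> X_primal N" "u' \<in> X_dual N" "\<phi>' \<in> X_primal N"
    and mass: "mass_balance g N dt \<rho> \<rho>' u'" and dt: "dt > 0"
    and poisson: "disc_poisson \<epsilon> N \<rho> \<phi>" "disc_poisson \<epsilon> N \<rho>' \<phi>'"
    and \<xi>: "\<And>i. i \<in> {0..int N} \<Longrightarrow>
      (exp (- pval N \<phi>' i) - exp (- pval N \<phi> i)) * pval N \<phi>' i
        = - (hfun (pval N \<phi>' i) - hfun (pval N \<phi> i)) - exp (- \<xi> i) * ((pval N \<phi>' i - pval N \<phi> i)\<^sup>2 / 2)"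
  shows "energy \<epsilon> N \<rho>' u' \<phi>' - energy \<epsilon> N \<rho> u \<phi> + dt * dissipation_step g \<epsilon> N dt \<rho> u \<phi> \<rho>' u' \<phi>' \<xi>
     = dt * dx N * (\<Sum>i\<in>{0..int N}. momentum_residual g N dt \<rho> u \<rho>' u' \<phi>' i * dval N u' i)"
proof -
  define d where "d = dx N"
  define c where "c = (\<epsilon> / d)\<^sup>2"
  define f f' r r' where "f = pval N \<phi>" and "f' = pval N \<phi>'" and "r = pval N \<rho>" and "r' = pval N \<rho>'"
  have d0: "d > 0" by (simp add: d_def dx_pos)
  have c: "c * d\<^sup>2 = \<epsilon>\<^sup>2" using d0 by (simp add: c_def power_divide)
  have per: "f \<in> periodic N" "f' \<in> periodic N" "r \<in> periodic N" "r' \<in> periodic N"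
    using X by (simp_all add: f_def f'_def r_def r'_def pval_per)
  have P: "poisson_seq c r f" "poisson_seq c r' f'"
    using poisson X by (simp_all add: disc_poisson_iff_seq c_def d_def f_def f'_def r_def r'_def)
  define K where "K = (\<Sum>i\<in>{0..int N}. rho_dual N \<rho>' i * ((dval N u' i)\<^sup>2 / 2) - rho_dual N \<rho> i * ((dval N u i)\<^sup>2 / 2))"
  define S where "S = (\<Sum>i\<in>{0..int N}. S_term g N dt \<rho> u \<rho>' u' i)"
  define Wk where "Wk = (\<Sum>i\<in>{0..int N}. rho_tilde g N \<rho>' u' i * dval N u' i * disc_delta N \<phi>' i)"
  define G2 where "G2 = (\<Sum>i\<in>{0..int N}. (f' (i + 1) - f' i)\<^sup>2 - (f (i + 1) - f i)\<^sup>2)"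
  define Gd where "Gd = (\<Sum>i\<in>{0..int N}. ((f' (i + 1) - f' i) - (f (i + 1) - f i))\<^sup>2)"
  define h where "h = (\<Sum>i\<in>{0..int N}. hfun (f' i) - hfun (f i))"
  define T where "T = (\<Sum>i\<in>{0..int N}. exp (- \<xi> i) * ((f' i - f i)\<^sup>2 / 2))"
  define L where "L = (\<Sum>i\<in>{0..int N}. (f' (i + 1) - 2 * f' i + f' (i - 1))\<^sup>2)"
  define M where "M = (\<Sum>i\<in>{0..int N}. \<bar>(exp (- f' i) - exp (- f' (i - 1))) * (f' i - f' (i - 1))\<bar>)"
  define RF where "RF = (\<Sum>i\<in>{0..int N}. (r' i - r i) * f' i)"
  have res: "(\<Sum>i\<in>{0..int N}. momentum_residual g N dt \<rho> u \<rho>' u' \<phi>' i * dval N u' i) = K / dt + S - Wk"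
    unfolding kinetic_balance[OF X(3,4) mass] K_def S_def Wk_def
    by (simp add: sum.distrib sum_subtractf sum_divide_distrib diff_divide_distrib)
  have work: "dt * (Wk * d) = RF * d + dt * g 0 * (- (c * L) - M)"
    using field_work[OF X(3-5) mass dt] poisson_seq_gradient_product[OF per(2,4) P(2)]
    unfolding Wk_def RF_def L_def M_def r_def r'_def f'_def d_def sum_distrib_right by simp
  have pot: "RF = - (c / 2 * (G2 + Gd)) - (h + T)"
    using potential_balance[OF per(1) P(1) per(2) P(2)] \<xi>
    unfolding RF_def G2_def Gd_def h_def T_def f_def f'_def by (simp add: sum.distrib)
  have q: "\<epsilon>\<^sup>2 / 2 * \<bar>x / dx N\<bar>\<^sup>2 = c / 2 * x\<^sup>2" for x
    by (simp add: c_def d_def power_divide)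
  have en: "energy \<epsilon> N \<rho>' u' \<phi>' - energy \<epsilon> N \<rho> u \<phi> = (K + c / 2 * G2 + h) * d"
    unfolding energy_def q K_def G2_def h_def sum_distrib_left sum_distrib_right
      sum.distrib[symmetric] sum_subtractf[symmetric]
    by (intro sum.cong refl)
      (simp add: d_def f_def f'_def algebra_simps)
  have "dissipation_step g \<epsilon> N dt \<rho> u \<phi> \<rho>' u' \<phi>' \<xi>
      = (S + T / dt) * d + c / 2 * Gd * d / dt + g 0 * (c * L) + g 0 * M"
  proof -
    have 1: "(\<Sum>i\<in>{0..int N}. (S_term g N dt \<rho> u \<rho>' u' i
         + exp (- \<xi> i) * ((pval N \<phi>' i - pval N \<phi> i)\<^sup>2 / (2 * dt))) * dx N) = (S + T / dt) * d"
      unfolding S_def T_def sum_divide_distrib sum.distrib[symmetric] sum_distrib_right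
      by (simp add: d_def f_def f'_def)
    have 2: "\<epsilon>\<^sup>2 / (2 * dt) * (\<Sum>i\<in>{0..int N}. (disc_delta N \<phi>' i - disc_delta N \<phi> i)\<^sup>2 * dx N)
        = c / 2 * Gd * d / dt"
    proof -
      have "(disc_delta N \<phi>' i - disc_delta N \<phi> i)\<^sup>2
          = ((f' (i + 1) - f' i) - (f (i + 1) - f i))\<^sup>2 / d\<^sup>2" for i
        by (simp add: disc_delta_def f_def f'_def d_def power_divide diff_divide_distrib[symmetric])
      then have "(\<Sum>i\<in>{0..int N}. (disc_delta N \<phi>' i - disc_delta N \<phi> i)\<^sup>2 * dx N) = Gd / d\<^sup>2 * d"
        unfolding Gd_def sum_divide_distrib sum_distrib_right d_def by simp
      then show ?thesis using d0 dt by (simp add: c_def power_divide ac_simps)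
    qed
    have 3: "g 0 / dx N * (\<Sum>i\<in>{0..int N}. \<epsilon>\<^sup>2 * \<bar>disc_delta N \<phi>' i - disc_delta N \<phi>' (i - 1)\<bar>\<^sup>2 * dx N)
        = g 0 * (c * L)"
    proof -
      have "\<epsilon>\<^sup>2 * \<bar>disc_delta N \<phi>' i - disc_delta N \<phi>' (i - 1)\<bar>\<^sup>2 * dx N
          = (f' (i + 1) - 2 * f' i + f' (i - 1))\<^sup>2 * (c * d)" for i
      proof -
        have "disc_delta N \<phi>' i - disc_delta N \<phi>' (i - 1) = (f' (i + 1) - 2 * f' i + f' (i - 1)) / d"
          by (simp add: disc_delta_def f'_def d_def diff_divide_distrib[symmetric])
        then show ?thesis by (simp add: c_def d_def power_divide)
      qed
      then have "(\<Sum>i\<in>{0..int N}. \<epsilon>\<^sup>2 * \<bar>disc_delta N \<phi>' i - disc_delta N \<phi>' (i - 1)\<bar>\<^sup>2 * dx N) = L * (c * d)"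
        unfolding L_def sum_distrib_right by simp
      then show ?thesis using d0 by (simp add: d_def)
    qed
    have 4: "g 0 / dx N * (\<Sum>i\<in>{0..int N}.
            \<bar>(exp (- pval N \<phi>' i) - exp (- pval N \<phi>' (i - 1))) * (pval N \<phi>' i - pval N \<phi>' (i - 1))\<bar> * dx N)
        = g 0 * M"
      using d0 unfolding sum_distrib_right[symmetric] M_def f'_def d_def by simp
    show ?thesis unfolding dissipation_step_def 1 2 3 4 ..
  qed
  then have "dt * dissipation_step g \<epsilon> N dt \<rho> u \<phi> \<rho>' u' \<phi>' \<xi>
      = dt * S * d + (T + c / 2 * Gd) * d + dt * g 0 * (c * L + M)"
    using dt by (simp add: field_simps)
  moreover have "dt * d * (K / dt + S - Wk) = K * d + dt * S * d - dt * (Wk * d)"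
    using dt by (simp add: field_simps)
  ultimately show ?thesis
    unfolding en res d_def[symmetric] work pot by (simp add: algebra_simps)
qed

text \<open>Only the flux terms of \<open>S_term\<close> have no evident sign. Upwinding settles
  them: whenever the flux has the unfavourable sign, the upwind velocity at that end is the velocity
  of the cell itself and the square vanishes.\<close>

lemma dissipation_step_nonneg:
  assumes "\<And>i. rho_dual N \<rho> i \<ge> 0" "g 0 \<ge> 0" "dt > 0"
  shows "dissipation_step g \<epsilon> N dt \<rho> u \<phi> \<rho>' u' \<phi>' \<xi> \<ge> 0"
proof -
  have d0: "dx N > 0" by (rule dx_pos)
  have "S_term g N dt \<rho> u \<rho>' u' i \<ge> 0" for i
  proof -
    have "- flux_primal g N \<rho>' u' (i + 1) * ((u_upwind g N \<rho>' u' (i + 1) - dval N u' i)\<^sup>2 / (2 * dx N)) \<ge> 0"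
    proof (cases "flux_primal g N \<rho>' u' (i + 1) \<ge> 0")
      case False
      then show ?thesis using d0 by (intro mult_nonneg_nonneg) auto
    qed (simp add: u_upwind_def)
    moreover have "flux_primal g N \<rho>' u' i * ((u_upwind g N \<rho>' u' i - dval N u' i)\<^sup>2 / (2 * dx N)) \<ge> 0"
      using d0 by (cases "flux_primal g N \<rho>' u' i \<ge> 0") (auto simp: u_upwind_def)
    moreover have "rho_dual N \<rho> i * ((dval N u i - dval N u' i)\<^sup>2 / (2 * dt)) \<ge> 0"
      using assms by simp
    ultimately show ?thesis unfolding S_term_def by linarith
  qed
  then show ?thesis
    unfolding dissipation_step_def using assms d0
    by (intro add_nonneg_nonneg mult_nonneg_nonneg sum_nonneg) auto
qed

section \<open>Solvability of a time step\<close>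

text \<open>The removable singularity at 0 is filled in, so that \<open>rho_tilde\<close> depends on
  the velocity through one continuous function and without a case distinction.\<close>

definition slope_at_0 :: "(real \<Rightarrow> real) \<Rightarrow> real \<Rightarrow> real" where
  "slope_at_0 g w = (if w = 0 then deriv g 0 else (g w - g 0) / w)"

lemma continuous_on_slope_at_0:
  assumes cont: "continuous_on UNIV g" and diff: "g differentiable (at 0)"
  shows "continuous_on UNIV (slope_at_0 g)"
proof -
  have "isCont (slope_at_0 g) w" for w
  proof (cases "w = 0")
    case True
    have "DERIV g 0 :> deriv g 0"
      using diff by (simp add: DERIV_deriv_iff_real_differentiable)
    then have "((\<lambda>y. (g y - g 0) / y) \<longlongrightarrow> deriv g 0) (at 0)"
      by (simp add: has_field_derivative_iff)
    then have "(slope_at_0 g \<longlongrightarrow> deriv g 0) (at 0)"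
      by (rule Lim_transform_eventually) (simp add: eventually_at_filter slope_at_0_def)
    then show ?thesis using True by (simp add: isCont_def slope_at_0_def)
  next
    case False
    have "continuous_on (- {0}) (\<lambda>w. (g w - g 0) / w)"
      by (intro continuous_intros continuous_on_subset[OF cont]) auto
    then have "continuous_on (- {0}) (slope_at_0 g)"
      by (subst continuous_on_cong[OF refl, where g = "\<lambda>w. (g w - g 0) / w"]) (auto simp: slope_at_0_def)
    then show ?thesis using False by (simp add: continuous_on_eq_continuous_at open_Compl)
  qed
  then show ?thesis by (simp add: continuous_at_imp_continuous_on)
qed

lemma rho_tilde_eq_slope:
  "rho_tilde g N \<rho> u i
     = pval N \<rho> (i + 1) + (pval N \<rho> i - pval N \<rho> (i + 1)) * slope_at_0 g (dval N u i)"
proof (cases "dval N u i = 0")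
  case False
  then show ?thesis
    by (simp add: rho_tilde_def Gfun_def slope_at_0_def divide_simps) (simp add: algebra_simps)
qed (simp add: rho_tilde_def slope_at_0_def algebra_simps)

text \<open>Although the upwind velocity jumps, the product is continuous: the positive and the
  negative part of the flux each multiply a fixed neighbour.\<close>

lemma flux_primal_mult_u_upwind:
  "flux_primal g N \<rho> u i * u_upwind g N \<rho> u i
     = max (flux_primal g N \<rho> u i) 0 * dval N u (i - 1) + min (flux_primal g N \<rho> u i) 0 * dval N u i"
  by (simp add: u_upwind_def)

lemma mass_balance_iff_upwind_op:
  assumes dt: "dt > 0"
  shows "mass_balance g N dt \<rho> \<rho>' u' \<longleftrightarrow>
    (\<forall>i. upwind_op (\<lambda>i. dt / dx N * g (dval N u' i)) (\<lambda>i. dt / dx N * (g (dval N u' i) - dval N u' i))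
           (pval N \<rho>') i = pval N \<rho> i)"
proof -
  have d0: "dx N > 0" by (rule dx_pos)
  have "upwind_op (\<lambda>i. dt / dx N * g (dval N u' i)) (\<lambda>i. dt / dx N * (g (dval N u' i) - dval N u' i))
           (pval N \<rho>') i
      = pval N \<rho>' i + dt / dx N * (flux_dual g N \<rho>' u' i - flux_dual g N \<rho>' u' (i - 1))" for i
    unfolding upwind_op_def flux_dual_def Gfun_def by (simp add: algebra_simps)
  moreover have "pval N \<rho>' i + dt / dx N * (flux_dual g N \<rho>' u' i - flux_dual g N \<rho>' u' (i - 1)) = pval N \<rho> i
     \<longleftrightarrow> (pval N \<rho>' i - pval N \<rho> i) / dt
          + (flux_dual g N \<rho>' u' i - flux_dual g N \<rho>' u' (i - 1)) / dx N = 0" for i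
    using d0 dt by (simp add: field_simps)
  ultimately show ?thesis unfolding mass_balance_def by simp
qed

lemma sum_pval_mass_balance:
  assumes "mass_balance g N dt \<rho> \<rho>' u'" "dt > 0" "\<rho>' \<in> X_primal N" "u' \<in> X_dual N"
  shows "(\<Sum>i\<in>{0..int N}. pval N \<rho>' i) = (\<Sum>i\<in>{0..int N}. pval N \<rho> i)"
proof -
  have "(\<Sum>i\<in>{0..int N}. (pval N \<rho>' i - pval N \<rho> i) / dt
          + (flux_dual g N \<rho>' u' i - flux_dual g N \<rho>' u' (i - 1)) / dx N) = 0"
    using assms(1) unfolding mass_balance_def by simp
  then show ?thesis
    using per_sum_telescope(2)[OF flux_dual_per[OF assms(3,4), of g]] assms(2)
    by (simp add: sum.distrib sum_subtractf flip: sum_divide_distrib)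
qed

section \<open>Velocity bound and existence of one time step\<close>

lemma lipschitz_growth:
  fixes g :: "real \<Rightarrow> real"
  assumes "L-lipschitz_on UNIV g" "\<bar>x\<bar> \<le> m"
  shows "g x \<le> g 0 + L * m"
proof -
  have "\<bar>g x - g 0\<bar> \<le> L * \<bar>x\<bar>" using lipschitz_onD[OF assms(1), of x 0] by (simp add: dist_real_def)
  also have "\<dots> \<le> L * m" using assms lipschitz_on_nonneg by (intro mult_left_mono) auto
  finally show ?thesis by linarith
qed

lemma velocity_bound_from_energy:
  assumes g: "L-lipschitz_on UNIV g" "\<And>v. g v \<ge> max v 0" and dt: "dt > 0"
    and X: "\<rho>' \<in> X_primal N" "u' \<in> X_dual N"
    and mass: "mass_balance g N dt \<rho> \<rho>' u'"
    and r0: "r0 > 0" "\<And>i. r0 \<le> pval N \<rho> i"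
    and pos: "\<And>i. pval N \<rho>' i > 0"
    and E: "energy \<epsilon> N \<rho>' u' \<phi>' \<le> E"
  shows "\<bar>dval N u' i\<bar> \<le> max 1 ((1 + dt / dx N * (2 * g 0 + 2 * L + 1)) * (4 * (E + 1) / dx N) / r0)"
proof -
  define d lam where "d = dx N" and "lam = dt / dx N"
  define z r' where "z = dval N u'" and "r' = pval N \<rho>'"
  \<comment> \<open>The factor 4 collects the 1/2 of the kinetic energy and the 1/2 lost in
    \<open>rho_dual N \<rho>' k\<close> \<ge> r' k / 2; the division by d appears because a single
    cell is kept.\<close>
  define C where "C = 4 * (E + 1) / d"
  \<comment> \<open>Chosen so that D m dominates the diagonal coefficient of the mass balance at k,
    by g(v) \<le> g(0) + L m and 1 \<le> m. This comparison is the reason for the maximum with 1 in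
    the bound.\<close>
  define D where "D = 1 + lam * (2 * g 0 + 2 * L + 1)"
  have d0: "d > 0" by (simp add: d_def dx_pos)
  then have lam: "lam \<ge> 0" using dt by (simp add: lam_def d_def)
  have L0: "L \<ge> 0" using g(1) by (rule lipschitz_on_nonneg)
  have g0: "g 0 \<ge> 0" using g(2)[of 0] by simp
  have D0: "D \<ge> 0" using lam L0 g0 by (simp add: D_def)
  have z: "z \<in> periodic N" using X by (simp add: z_def dval_per)
  obtain k where k: "k \<in> {0..int N}" "\<And>i. \<bar>z i\<bar> \<le> \<bar>z k\<bar>"
    using per_obtains_max[of "\<lambda>i. \<bar>z i\<bar>" N] z by (auto simp: per_arith)
  define m where "m = \<bar>z k\<bar>"
  have rd: "rho_dual N \<rho>' i \<ge> 0" for i using pos by (simp add: rho_dual_def less_imp_le add_nonneg_nonneg)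
  have "rho_dual N \<rho>' k * ((z k)\<^sup>2 / 2) * d \<le> (\<Sum>i\<in>{0..int N}. rho_dual N \<rho>' i * ((z i)\<^sup>2 / 2) * d)"
    using k(1) rd d0 by (intro member_le_sum[where f = "\<lambda>i. rho_dual N \<rho>' i * ((z i)\<^sup>2 / 2) * d"]) auto
  \<comment> \<open>Taking d off in each of the N + 1 cells removes 1 in total and makes room for h
    \<ge> -1 in every cell.\<close>
  also have "\<dots> = (\<Sum>i\<in>{0..int N}. rho_dual N \<rho>' i * ((z i)\<^sup>2 / 2) * d - d) + 1"
    using sum_dx[of 1 N] by (simp add: sum_subtractf d_def)
  also have "(\<Sum>i\<in>{0..int N}. rho_dual N \<rho>' i * ((z i)\<^sup>2 / 2) * d - d) \<le> energy \<epsilon> N \<rho>' u' \<phi>'"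
    unfolding energy_def
  proof (rule sum_mono)
    fix i
    have "rho_dual N \<rho>' i * ((z i)\<^sup>2 / 2) - 1 \<le> rho_dual N \<rho>' i * ((dval N u' i)\<^sup>2 / 2)
        + \<epsilon>\<^sup>2 / 2 * \<bar>(pval N \<phi>' (i + 1) - pval N \<phi>' i) / dx N\<bar>\<^sup>2 + hfun (pval N \<phi>' i)"
      using add_mono[OF mult_nonneg_nonneg[OF _ zero_le_power2] hfun_ge[of "pval N \<phi>' i"],
          of "\<epsilon>\<^sup>2 / 2" "\<bar>(pval N \<phi>' (i + 1) - pval N \<phi>' i) / dx N\<bar>"]
      unfolding z_def by simp
    from mult_right_mono[OF this, of d] show "rho_dual N \<rho>' i * ((z i)\<^sup>2 / 2) * d - d
        \<le> (rho_dual N \<rho>' i * ((dval N u' i)\<^sup>2 / 2)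
        + \<epsilon>\<^sup>2 / 2 * \<bar>(pval N \<phi>' (i + 1) - pval N \<phi>' i) / dx N\<bar>\<^sup>2 + hfun (pval N \<phi>' i)) * dx N"
      using d0 by (simp add: d_def left_diff_distrib)
  qed
  also have "energy \<epsilon> N \<rho>' u' \<phi>' + 1 \<le> E + 1" using E by simp
  finally have "rho_dual N \<rho>' k * m\<^sup>2 \<le> C / 2" using d0 by (simp add: C_def m_def field_simps)
  moreover have "r' k / 2 * m\<^sup>2 \<le> rho_dual N \<rho>' k * m\<^sup>2"
    using pos[of "k + 1"] by (intro mult_right_mono) (auto simp: rho_dual_def r'_def)
  ultimately have rm: "r' k * m\<^sup>2 \<le> C" by simp
  let ?a = "\<lambda>i. lam * g (z i)" and ?b = "\<lambda>i. lam * (g (z i) - z i)"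
  have ab: "?a i \<ge> 0" "?b i \<ge> 0" for i using lam g(2)[of "z i"] by auto
  have up: "upwind_op ?a ?b r' i = pval N \<rho> i" for i
    using mass unfolding mass_balance_iff_upwind_op[OF dt] lam_def z_def r'_def by blast
  have "upwind_op ?a ?b r' k \<le> (1 + ?a k + ?b (k - 1)) * r' k"
    using mult_nonneg_nonneg[OF ab(1)[of "k - 1"] less_imp_le[OF pos[of "k - 1"]]]
      mult_nonneg_nonneg[OF ab(2)[of k] less_imp_le[OF pos[of "k + 1"]]]
    by (simp add: upwind_op_def r'_def)
  then have lower: "r0 \<le> (1 + ?a k + ?b (k - 1)) * r' k" using up[of k] r0(2)[of k] by simp
  have "m \<le> max 1 (D * C / r0)"
  proof (cases "m \<le> 1")
    case False
    have "g (z k) \<le> g 0 + L * m" "g (z (k - 1)) \<le> g 0 + L * m" "- z (k - 1) \<le> m"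
      using k(2)[of k] k(2)[of "k - 1"] by (auto intro: lipschitz_growth[OF g(1)] simp: m_def)
    then have "g (z k) + (g (z (k - 1)) - z (k - 1)) \<le> 2 * g 0 + (2 * L + 1) * m"
      by (simp add: algebra_simps)
    also have "\<dots> \<le> (2 * g 0) * m + (2 * L + 1) * m" using False g0 by (simp add: mult_le_cancel_left1)
    finally have "lam * (g (z k) + (g (z (k - 1)) - z (k - 1))) \<le> lam * ((2 * g 0) * m + (2 * L + 1) * m)"
      using lam by (rule mult_left_mono)
    then have "1 + lam * (g (z k) + (g (z (k - 1)) - z (k - 1))) \<le> m + lam * ((2 * g 0) * m + (2 * L + 1) * m)"
      using False by linarith
    then have "1 + ?a k + ?b (k - 1) \<le> D * m" by (simp add: D_def algebra_simps)
    then have "(1 + ?a k + ?b (k - 1)) * r' k \<le> D * m * r' k"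
      using pos[of k] by (intro mult_right_mono) (auto simp: r'_def)
    with lower have "r0 \<le> D * m * r' k" by linarith
    then have "r0 * m \<le> (D * m * r' k) * m" using False by (intro mult_right_mono) auto
    also have "\<dots> = D * (r' k * m\<^sup>2)" by (simp add: power2_eq_square ac_simps)
    also have "\<dots> \<le> D * C" using rm D0 by (rule mult_left_mono)
    finally have "m \<le> D * C / r0" using r0(1) by (simp add: field_simps)
    then show ?thesis by simp
  qed simp
  then show ?thesis
    using k(2)[of i] unfolding m_def z_def D_def C_def lam_def d_def by linarith
qed

lemma scheme_stepI:
  assumes "mass_balance g N dt \<rho> \<rho>' u'"
    and "\<And>i. i \<in> {0..int N} \<Longrightarrow> momentum_residual g N dt \<rho> u \<rho>' u' \<phi>' i = 0"
    and "disc_poisson \<epsilon> N \<rho>' \<phi>'"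
  shows "scheme_step g \<epsilon> N dt \<rho> u \<rho>' u' \<phi>'"
  using assms unfolding scheme_step_def mass_balance_def momentum_residual_def by simp

lemma scheme_step_exists:
  assumes g: "L-lipschitz_on UNIV g" "g differentiable (at 0)" "\<And>v. g v \<ge> max v 0"
    and pos: "\<epsilon> > 0" "dt > 0"
    and X: "\<rho> \<in> X_primal N" "u \<in> X_dual N" "\<phi> \<in> X_primal N"
    and \<rho>: "\<And>i. pval N \<rho> i > 0"
    and poisson: "disc_poisson \<epsilon> N \<rho> \<phi>"
  obtains \<rho>' u' \<phi>' where "\<rho>' \<in> X_primal N" "u' \<in> X_dual N" "\<phi>' \<in> X_primal N"
    "\<And>i. pval N \<rho>' i > 0" "mass_balance g N dt \<rho> \<rho>' u'"
    "\<And>i. i \<in> {0..int N} \<Longrightarrow> momentum_residual g N dt \<rho> u \<rho>' u' \<phi>' i = 0"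
    "disc_poisson \<epsilon> N \<rho>' \<phi>'"
proof -
  define r c lam where "r = pval N \<rho>" and "c = (\<epsilon> / dx N)\<^sup>2" and "lam = dt / dx N"
  have r: "r \<in> periodic N" using X by (simp add: r_def pval_per)
  have c0: "c \<ge> 0" by (simp add: c_def)
  have lam: "lam \<ge> 0" using pos dx_pos[of N] by (simp add: lam_def)
  have contg: "continuous_on UNIV g" using g(1) by (rule lipschitz_on_continuous_on)
  define A B where "A z = (\<lambda>i. lam * g (z i))" and "B z = (\<lambda>i. lam * (g (z i) - z i))"
    for z :: "int \<Rightarrow> real"
  have AB: "A z \<in> periodic N" "B z \<in> periodic N" if "z \<in> periodic N" for z
    using that unfolding A_def B_def by (simp_all add: periodic_def)
  have AB0: "A z i \<ge> 0" "B z i \<ge> 0" for z i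
    using lam g(3)[of "z i"] unfolding A_def B_def by auto
  have cg: "continuous_on Z (\<lambda>z. g (z i))" for Z :: "(int \<Rightarrow> real) set" and i
    by (rule continuous_on_compose2[OF contg continuous_on_per_coordinate]) auto
  have "\<forall>z\<in>periodic N. \<exists>x. x \<in> periodic N \<and> (\<forall>i. upwind_op (A z) (B z) x i = r i)"
    using upwind_op_surj[OF AB r AB0] by blast
  then obtain R where R: "\<And>z. z \<in> periodic N \<Longrightarrow> R z \<in> periodic N"
      "\<And>z i. z \<in> periodic N \<Longrightarrow> upwind_op (A z) (B z) (R z) i = r i"
    by metis
  have Rpos: "R z i > 0" if "z \<in> periodic N" for z i
    by (rule upwind_op_positive(1)[OF AB[OF that] R(1)[OF that] AB0])
      (use R(2)[OF that] \<rho> in \<open>simp add: r_def\<close>)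
  have contR: "continuous_on (periodic N) (\<lambda>z. R z i)" for i
    by (rule upwind_op_solution_continuous[where a = A and b = B and r = r and N = N])
      (use AB AB0 R in \<open>auto simp: A_def B_def intro!: continuous_intros cg continuous_on_per_coordinate\<close>)
  have "\<forall>z\<in>periodic N. \<exists>f. f \<in> periodic N \<and> poisson_seq c (R z) f"
    using poisson_seq_exists[OF c0 R(1) Rpos] by blast
  then obtain F where F: "\<And>z. z \<in> periodic N \<Longrightarrow> F z \<in> periodic N"
      "\<And>z. z \<in> periodic N \<Longrightarrow> poisson_seq c (R z) (F z)"
    by metis
  have contF: "continuous_on (periodic N) (\<lambda>z. F z i)" for i
    by (rule poisson_seq_solution_continuous[OF c0 F(1) Rpos contR F(2)])
  define \<rho>' u' \<phi>' where "\<rho>' z = plift N (R z)" and "u' z = dlift N z" and "\<phi>' z = plift N (F z)" for z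
  have X': "\<rho>' z \<in> X_primal N" "u' z \<in> X_dual N" "\<phi>' z \<in> X_primal N" if "z \<in> periodic N" for z
    using that R F by (simp_all add: \<rho>'_def u'_def \<phi>'_def plift_in_X dlift_in_X)
  have pos': "pval N (\<rho>' z) i > 0" if "z \<in> periodic N" for z i
    using Rpos[OF that] by (simp add: \<rho>'_def)
  have mass: "mass_balance g N dt \<rho> (\<rho>' z) (u' z)" if "z \<in> periodic N" for z
    unfolding mass_balance_iff_upwind_op[OF pos(2)]
    using R(2)[OF that] unfolding A_def B_def lam_def r_def
    by (simp add: \<rho>'_def u'_def pval_plift[abs_def])
  have poisson': "disc_poisson \<epsilon> N (\<rho>' z) (\<phi>' z)" if "z \<in> periodic N" for z
    using F(2)[OF that] unfolding disc_poisson_iff_seq[OF X'(1)[OF that] X'(3)[OF that]]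
    by (simp add: \<rho>'_def \<phi>'_def c_def poisson_seq_def)
  let ?res = "\<lambda>z. momentum_residual g N dt \<rho> u (\<rho>' z) (u' z) (\<phi>' z)"
  have cont: "continuous_on (periodic N) (\<lambda>z. ?res z i)" for i
  proof -
    have cf: "continuous_on (periodic N) (\<lambda>z. flux_primal g N (\<rho>' z) (u' z) j)" for j
      unfolding flux_primal_def flux_dual_def Gfun_def \<rho>'_def u'_def pval_plift dval_dlift
      by (intro continuous_intros contR cg continuous_on_per_coordinate) auto
    have cs: "continuous_on (periodic N) (\<lambda>z. slope_at_0 g (z j))" for j
      by (rule continuous_on_compose2[OF continuous_on_slope_at_0[OF contg g(2)] continuous_on_per_coordinate]) auto
    have "continuous_on (periodic N) (\<lambda>z. max (flux_primal g N (\<rho>' z) (u' z) j) 0 * z k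
              + min (flux_primal g N (\<rho>' z) (u' z) j) 0 * z l)" for j k l
      by (intro continuous_intros cf continuous_on_per_coordinate)
    then have cfu: "continuous_on (periodic N) (\<lambda>z. flux_primal g N (\<rho>' z) (u' z) j * u_upwind g N (\<rho>' z) (u' z) j)" for j
      unfolding flux_primal_mult_u_upwind by (simp add: u'_def)
    have ct: "continuous_on (periodic N) (\<lambda>z. rho_tilde g N (\<rho>' z) (u' z) i * disc_delta N (\<phi>' z) i)"
      unfolding rho_tilde_eq_slope disc_delta_def \<rho>'_def \<phi>'_def u'_def pval_plift dval_dlift
      using dx_pos[of N] by (intro continuous_intros cs contR contF) auto
    have cr: "continuous_on (periodic N) (\<lambda>z. rho_dual N (\<rho>' z) i * dval N (u' z) i)"
      unfolding rho_dual_def \<rho>'_def u'_def pval_plift dval_dlift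
      by (intro continuous_intros contR continuous_on_per_coordinate) auto
    show ?thesis
      unfolding momentum_residual_def
      using dx_pos[of N] pos(2) by (intro continuous_on_add continuous_on_diff continuous_on_divide
          continuous_on_const cfu ct cr) auto
  qed
  obtain k0 where k0: "\<And>i. r k0 \<le> r i" using per_obtains_min[OF r] by metis
  \<comment> \<open>\<open>velocity_bound_from_energy\<close> with the old energy as E and the
    smallest old density as r0; it does not depend on the homotopy parameter.\<close>
  define K where "K = max 1 ((1 + dt / dx N * (2 * g 0 + 2 * L + 1)) * (4 * (energy \<epsilon> N \<rho> u \<phi> + 1) / dx N) / r k0)"
  have "\<exists>z\<in>periodic N. \<forall>i\<in>{0..int N}. ?res z i = 0"
  proof (rule per_zero_exists[where K = K])
    show "continuous_on (periodic N) (\<lambda>z. ?res z i)" for i by (rule cont)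
  next
    fix t :: real and z i
    assume z: "z \<in> periodic N" and t: "0 \<le> t" "t \<le> 1"
      and eq: "\<And>i. i \<in> {0..int N} \<Longrightarrow> (1 - t) * z i + t * ?res z i = 0" and i: "i \<in> {0..int N}"
    show "\<bar>z i\<bar> \<le> K"
    proof (cases "t = 0")
      case True
      then show ?thesis using eq[OF i] by (simp add: K_def)
    next
      case False
      \<comment> \<open>Testing with z itself: the identity part of the homotopy gives the
        nonnegative sum of z^2, so the residual tested with z is nonpositive and the energy cannot
        exceed its old value.\<close>
      have "(1 - t) * (\<Sum>i\<in>{0..int N}. (z i)\<^sup>2) + t * (\<Sum>i\<in>{0..int N}. ?res z i * z i)
          = (\<Sum>i\<in>{0..int N}. ((1 - t) * z i + t * ?res z i) * z i)"
        unfolding sum_distrib_left sum.distrib[symmetric]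
        by (intro sum.cong refl) (simp add: power2_eq_square algebra_simps)
      also have "\<dots> = 0" using eq by simp
      finally have "t * (\<Sum>i\<in>{0..int N}. ?res z i * z i) = - ((1 - t) * (\<Sum>i\<in>{0..int N}. (z i)\<^sup>2))"
        by linarith
      also have "\<dots> \<le> 0" using t by (simp add: sum_nonneg)
      finally have le: "(\<Sum>i\<in>{0..int N}. ?res z i * z i) \<le> 0"
        using t False by (simp add: mult_le_0_iff)
      \<comment> \<open>These intermediate points depend on the trial velocity; for the bound they
        matter only through the sign of the dissipation.\<close>
      have "\<forall>i. \<exists>\<xi>. (exp (- pval N (\<phi>' z) i) - exp (- pval N \<phi> i)) * pval N (\<phi>' z) i
        = - (hfun (pval N (\<phi>' z) i) - hfun (pval N \<phi> i)) - exp (- \<xi>) * ((pval N (\<phi>' z) i - pval N \<phi> i)\<^sup>2 / 2)"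
        using exp_minus_taylor2 by metis
      then obtain \<xi> where \<xi>: "\<And>i. (exp (- pval N (\<phi>' z) i) - exp (- pval N \<phi> i)) * pval N (\<phi>' z) i
        = - (hfun (pval N (\<phi>' z) i) - hfun (pval N \<phi> i)) - exp (- \<xi> i) * ((pval N (\<phi>' z) i - pval N \<phi> i)\<^sup>2 / 2)"
        by metis
      have "rho_dual N \<rho> i \<ge> 0" for i using \<rho> by (simp add: rho_dual_def less_imp_le add_nonneg_nonneg)
      moreover have "g 0 \<ge> 0" using g(3)[of 0] by simp
      ultimately have dis: "dt * dissipation_step g \<epsilon> N dt \<rho> u \<phi> (\<rho>' z) (u' z) (\<phi>' z) \<xi> \<ge> 0"
        using pos(2) by (intro mult_nonneg_nonneg dissipation_step_nonneg) auto
      have "dt * dx N * (\<Sum>i\<in>{0..int N}. ?res z i * dval N (u' z) i) \<le> 0"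
        using le pos(2) dx_pos[of N] by (intro mult_nonneg_nonpos) (auto simp: u'_def)
      then have "energy \<epsilon> N (\<rho>' z) (u' z) (\<phi>' z) \<le> energy \<epsilon> N \<rho> u \<phi>"
        using energy_balance[OF X(1,3) X'[OF z] mass[OF z] pos(2) poisson poisson'[OF z] \<xi>, of u] dis
        by linarith
      from velocity_bound_from_energy[OF g(1,3) pos(2) X'(1,2)[OF z] mass[OF z] _ _ pos'[OF z] this, of "r k0" i]
      show ?thesis using \<rho> k0 unfolding K_def r_def by (simp add: u'_def)
    qed
  qed
  then obtain z where z: "z \<in> periodic N" "\<forall>i\<in>{0..int N}. ?res z i = 0" by blast
  show ?thesis
    by (rule that[of "\<rho>' z" "u' z" "\<phi>' z"]) (use X' pos' mass poisson' z in auto)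
qed

section \<open>Marching in time\<close>

theorem theorem4:
  fixes g :: "real \<Rightarrow> real" and \<epsilon> T :: real and N NT :: nat
    and \<rho>ini uini \<rho>0 u0 \<phi>0 :: "real \<Rightarrow> real"
  assumes g_lipschitz: "\<exists>L. L-lipschitz_on UNIV g"
    and g_diff: "g differentiable (at 0)"
    and g_ge: "\<And>v. g v \<ge> max v 0"
    and pos: "\<epsilon> > 0" "T > 0" "NT > 0" "N > 0"
    and ini: "torus_fun \<rho>ini" "torus_integrable \<rho>ini" "\<And>x. \<rho>ini x \<ge> 0"
             "torus_fun uini" "torus_integrable uini"
    and \<rho>0: "\<rho>0 \<in> X_primal N"
            "\<And>i. i \<in> {0..int N} \<Longrightarrow>
               pval N \<rho>0 i = 1 / dx N * (LINT x:primal_cell N i|lebesgue. \<rho>ini x)"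
            "\<And>x. \<rho>0 x > 0"
    and u0: "u0 \<in> X_dual N"
            "\<And>i. i \<in> {0..int N} \<Longrightarrow>
               dval N u0 i = 1 / dx N * (LINT x:dual_cell N i|lebesgue. uini x)"
    and \<phi>0: "\<phi>0 \<in> X_primal N" "disc_poisson \<epsilon> N \<rho>0 \<phi>0"
  shows "\<exists>(\<rho> :: nat \<Rightarrow> real \<Rightarrow> real) (u :: nat \<Rightarrow> real \<Rightarrow> real) (\<phi> :: nat \<Rightarrow> real \<Rightarrow> real).
    scheme_solution g \<epsilon> N T NT \<rho> u \<phi> \<and> \<rho> 0 = \<rho>0 \<and> u 0 = u0 \<and> \<phi> 0 = \<phi>0 \<and>
    (\<forall>n\<le>NT. \<forall>x. \<rho> n x > 0) \<and>
    (\<forall>n\<le>NT. Lp_norm 1 (\<rho> n) = Lp_norm 1 \<rho>0) \<and>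
    (\<exists>\<xi> :: nat \<Rightarrow> int \<Rightarrow> real.
       (\<forall>n<NT. \<forall>i\<in>{0..int N}.
          strictly_between (pval N (\<phi> n) i) (pval N (\<phi> (n + 1)) i) (\<xi> n i)) \<and>
       (\<forall>k\<in>{1..NT}. dissipation g \<epsilon> N (T / real NT) \<rho> u \<phi> \<xi> k \<ge> 0) \<and>
       (\<forall>n\<le>NT.
          energy \<epsilon> N (\<rho> n) (u n) (\<phi> n)
            + T / real NT * (\<Sum>k=1..n. dissipation g \<epsilon> N (T / real NT) \<rho> u \<phi> \<xi> k)
          = energy \<epsilon> N \<rho>0 u0 \<phi>0)) \<and>
    (\<forall>n\<le>NT. elliptic_estimates \<epsilon> N (\<rho> n) (\<phi> n))"
proof -
  define dt where "dt = T / real NT"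
  have dt: "dt > 0" using pos by (simp add: dt_def)
  obtain L where L: "L-lipschitz_on UNIV g" using g_lipschitz by blast
  have g0: "g 0 \<ge> 0" using g_ge[of 0] by simp
  \<comment> \<open>The Poisson equation belongs to the invariant because the energy balance of a
    step subtracts the equations at both of its ends; for the first step this is the compatibility
    of \<phi>0 with \<rho>0.\<close>
  define Inv where "Inv s \<longleftrightarrow> (case s of (\<rho>, u, \<phi>) \<Rightarrow> \<rho> \<in> X_primal N \<and> u \<in> X_dual N \<and> \<phi> \<in> X_primal N \<and>
      (\<forall>i. pval N \<rho> i > 0) \<and> disc_poisson \<epsilon> N \<rho> \<phi>)" for s
  define Step where "Step s s' \<longleftrightarrow> (case s of (\<rho>, u, \<phi>) \<Rightarrow> case s' of (\<rho>', u', \<phi>') \<Rightarrow>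
      mass_balance g N dt \<rho> \<rho>' u' \<and> (\<forall>i\<in>{0..int N}. momentum_residual g N dt \<rho> u \<rho>' u' \<phi>' i = 0))"
    for s s' :: "(real \<Rightarrow> real) \<times> (real \<Rightarrow> real) \<times> (real \<Rightarrow> real)"
  \<comment> \<open>Every admissible state has a successor, so the sequence is built for all n and
    read off up to NT. The clause for n = 0 fixes the initial data.\<close>
  have "\<exists>S. \<forall>n. (Inv (S n) \<and> (n = 0 \<longrightarrow> S n = (\<rho>0, u0, \<phi>0))) \<and> Step (S n) (S (Suc n))"
  proof (rule dependent_nat_choice)
    show "\<exists>s. Inv s \<and> ((0 :: nat) = 0 \<longrightarrow> s = (\<rho>0, u0, \<phi>0))"
      using \<rho>0 u0 \<phi>0 by (simp add: Inv_def pval_def)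
  next
    fix s and n :: nat
    assume "Inv s \<and> (n = 0 \<longrightarrow> s = (\<rho>0, u0, \<phi>0))"
    moreover obtain \<rho> u \<phi> where s: "s = (\<rho>, u, \<phi>)" by (cases s)
    ultimately obtain \<rho>' u' \<phi>' where "\<rho>' \<in> X_primal N" "u' \<in> X_dual N" "\<phi>' \<in> X_primal N"
      "\<And>i. pval N \<rho>' i > 0" "mass_balance g N dt \<rho> \<rho>' u'"
      "\<And>i. i \<in> {0..int N} \<Longrightarrow> momentum_residual g N dt \<rho> u \<rho>' u' \<phi>' i = 0"
      "disc_poisson \<epsilon> N \<rho>' \<phi>'"
      using scheme_step_exists[OF L g_diff g_ge pos(1) dt, of \<rho> N u \<phi>] by (auto simp: Inv_def)
    then show "\<exists>s'. (Inv s' \<and> (Suc n = 0 \<longrightarrow> s' = (\<rho>0, u0, \<phi>0))) \<and> Step s s'"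
      by (intro exI[of _ "(\<rho>', u', \<phi>')"]) (simp add: Inv_def Step_def s)
  qed
  then obtain S where S: "\<And>n. Inv (S n)" "S 0 = (\<rho>0, u0, \<phi>0)" "\<And>n. Step (S n) (S (Suc n))" by blast
  define \<rho> u \<phi> where "\<rho> n = fst (S n)" and "u n = fst (snd (S n))" and "\<phi> n = snd (snd (S n))" for n
  have X: "\<rho> n \<in> X_primal N" "u n \<in> X_dual N" "\<phi> n \<in> X_primal N" for n
    using S(1)[of n] by (auto simp: Inv_def \<rho>_def u_def \<phi>_def split: prod.splits)
  have pv: "pval N (\<rho> n) i > 0" and poisson: "disc_poisson \<epsilon> N (\<rho> n) (\<phi> n)" for n i
    using S(1)[of n] by (auto simp: Inv_def \<rho>_def u_def \<phi>_def split: prod.splits)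
  have mass: "mass_balance g N dt (\<rho> n) (\<rho> (Suc n)) (u (Suc n))"
    and res: "i \<in> {0..int N} \<Longrightarrow>
       momentum_residual g N dt (\<rho> n) (u n) (\<rho> (Suc n)) (u (Suc n)) (\<phi> (Suc n)) i = 0" for n i
    using S(3)[of n] by (auto simp: Step_def \<rho>_def u_def \<phi>_def split: prod.splits)
  have init: "\<rho> 0 = \<rho>0" "u 0 = u0" "\<phi> 0 = \<phi>0" using S(2) by (simp_all add: \<rho>_def u_def \<phi>_def)
  have "\<forall>n i. \<exists>\<xi>. strictly_between (pval N (\<phi> n) i) (pval N (\<phi> (n + 1)) i) \<xi> \<and>
      (exp (- pval N (\<phi> (Suc n)) i) - exp (- pval N (\<phi> n) i)) * pval N (\<phi> (Suc n)) i
        = - (hfun (pval N (\<phi> (Suc n)) i) - hfun (pval N (\<phi> n) i))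
          - exp (- \<xi>) * ((pval N (\<phi> (Suc n)) i - pval N (\<phi> n) i)\<^sup>2 / 2)"
    using exp_minus_taylor2 by (metis Suc_eq_plus1)
  then obtain \<xi> where \<xi>: "\<And>n i. strictly_between (pval N (\<phi> n) i) (pval N (\<phi> (n + 1)) i) (\<xi> n i)"
    "\<And>n i. (exp (- pval N (\<phi> (Suc n)) i) - exp (- pval N (\<phi> n) i)) * pval N (\<phi> (Suc n)) i
        = - (hfun (pval N (\<phi> (Suc n)) i) - hfun (pval N (\<phi> n) i))
          - exp (- \<xi> n i) * ((pval N (\<phi> (Suc n)) i - pval N (\<phi> n) i)\<^sup>2 / 2)"
    by metis
  have sol: "scheme_solution g \<epsilon> N T NT \<rho> u \<phi>"
    unfolding scheme_solution_def dt_def[symmetric]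
    using X scheme_stepI[OF mass res poisson] by simp
  have posx: "\<rho> n x > 0" for n x
    using X_primal_eq[OF X(1), of n x] pv by simp
  have L1: "Lp_norm 1 (\<rho> n) = Lp_norm 1 \<rho>0" for n
  proof -
    have "(\<Sum>i\<in>{0..int N}. pval N (\<rho> n) i) = (\<Sum>i\<in>{0..int N}. pval N \<rho>0 i)"
      by (induction n) (use sum_pval_mass_balance[OF mass dt X(1,2)] init in auto)
    moreover have "Lp_norm 1 (\<rho> k) = (\<Sum>i\<in>{0..int N}. pval N (\<rho> k) i) * dx N" for k
      using pv by (simp add: Lp_norm_1_X_primal[OF X(1)] less_imp_le sum_distrib_right)
    ultimately show ?thesis using init by metis
  qed
  have diss: "dissipation g \<epsilon> N dt \<rho> u \<phi> \<xi> k \<ge> 0" for k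
    unfolding dissipation_def
    using pv g0 dt by (intro dissipation_step_nonneg) (auto simp: rho_dual_def less_imp_le add_nonneg_nonneg)
  have en: "energy \<epsilon> N (\<rho> n) (u n) (\<phi> n) + dt * (\<Sum>k=1..n. dissipation g \<epsilon> N dt \<rho> u \<phi> \<xi> k)
      = energy \<epsilon> N \<rho>0 u0 \<phi>0" for n
  proof (induction n)
    case (Suc n)
    \<comment> \<open>At index Suc n the dissipation reads \<open>\<xi> n\<close>, the points
      belonging to the step from n to Suc n, and the tested residual vanishes.\<close>
    have "energy \<epsilon> N (\<rho> (Suc n)) (u (Suc n)) (\<phi> (Suc n)) - energy \<epsilon> N (\<rho> n) (u n) (\<phi> n)
        + dt * dissipation g \<epsilon> N dt \<rho> u \<phi> \<xi> (Suc n) = 0"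
      using energy_balance[OF X(1,3)[of n] X[of "Suc n"] mass[of n] dt poisson[of n] poisson[of "Suc n"] \<xi>(2),
          of "u n"] res
      by (simp add: dissipation_def)
    with Suc show ?case by (simp add: algebra_simps)
  qed (simp add: init)
  have ell: "elliptic_estimates \<epsilon> N (\<rho> n) (\<phi> n)" for n
    by (rule elliptic_estimates_hold[OF X(1,3) pv poisson pos(1)])
  show ?thesis
    using sol init posx L1 \<xi>(1) diss en ell unfolding dt_def
    by (intro exI[of _ \<rho>] exI[of _ u] exI[of _ \<phi>]) blast
qed

end
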